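(* Let $Y$ be a complex Banach space of dimension at least two and $(\Omega,\Sigma,\mu)$ a measure space such that the complex space $L_\infty(\mu)$ has dimension at least two. Then the subspace $\mathcal K(L_\infty(\mu),Y)$ has the BPBp-RSE if and only if $Y$ is $\mathbb C$-uniformly convex.
   Context: All Banach spaces here are complex; $B_X$, $S_X$ are the closed unit ball and unit sphere of $X$; $\mathbb T=\{\lambda\in\mathbb C:|\lambda|=1\}$; $\mathcal L(X,Y)$ and $\mathcal K(X,Y)$ are the spaces of bounded and of compact linear operators. An operator $T\in\mathcal L(X,Y)$ is range strongly exposing, $T\in\mathrm{RSE}(X,Y)$, if there is $x_0\in S_X$ such that whenever $(x_n)\subseteq B_X$ satisfies $\|Tx_n\|\to\|T\|$, there are a subsequence $(x_{\sigma(n)})$ and $\lambda\in\mathbb T$ with $Tx_{\sigma(n)}\to\lambda Tx_0$. A linear subspace $\mathcal M\subseteq\mathcal L(X,Y)$ has the BPBp-RSE if for every $\varepsilon>0$ there is $0<\eta(\varepsilon)<\varepsilon$ such that for every $T\in\mathcal M$ with $\|T\|=1$ and every $x\in S_X$ with $\|Tx\|>1-\eta(\varepsilon)$, there exist $S\in\mathrm{RSE}(X,Y)\cap\mathcal M$ and $x_0\in S_X$ with $\|S\|=\|Sx_0\|=1$, $\|S-T\|<\varepsilon$ and $\|x-x_0\|<\varepsilon$. A complex Banach space $Y$ is $\mathbb C$-uniformly convex if for every $\varepsilon>0$ there is $\delta>0$ such that whenever $y_0,y_1\in Y$ satisfy $\|y_0+wy_1\|\le 1$ for every $w\in\mathbb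 T$ and $\|y_1\|>\varepsilon$, one has $\|y_0\|<1-\delta$. *)

theory Defs
  imports "HOL-Analysis.Analysis" "HOL-Probability.Essential_Supremum"
begin

section \<open>Complex Banach spaces\<close>

class complex_banach = banach +
  fixes scaleC :: "complex \<Rightarrow> 'a \<Rightarrow> 'a" (infixr "*\<^sub>C" 75)
  assumes scaleC_add_right: "a *\<^sub>C (x + y) = a *\<^sub>C x + a *\<^sub>C y"
    and scaleC_add_left: "(a + b) *\<^sub>C x = a *\<^sub>C x + b *\<^sub>C x"
    and scaleC_scaleC: "a *\<^sub>C b *\<^sub>C x = (a * b) *\<^sub>C x"
    and scaleC_of_real: "complex_of_real r *\<^sub>C x = r *\<^sub>R x"
    and norm_scaleC: "norm (a *\<^sub>C x) = cmod a * norm x"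

definition C_uniformly_convex :: "'y::complex_banach itself \<Rightarrow> bool" where
  "C_uniformly_convex _ \<longleftrightarrow>
     (\<forall>\<epsilon>>0. \<exists>\<delta>>0. \<forall>y0 y1 :: 'y.
        (\<forall>w. cmod w = 1 \<longrightarrow> norm (y0 + w *\<^sub>C y1) \<le> 1) \<and> norm y1 > \<epsilon> \<longrightarrow> norm y0 < 1 - \<delta>)"


section \<open>Complex normed spaces with an explicit carrier\<close>

text \<open>
  The space \<open>L\<^sub>\<infinity>(\<mu>)\<close> depends on the measure and hence cannot be a type, so the domain of an
  operator is given by a carrier with its operations.
\<close>

record 'x cspace =
  cs_carrier :: "'x set"
  cs_zero :: 'x
  cs_add :: "'x \<Rightarrow> 'x \<Rightarrow> 'x"
  cs_smult :: "complex \<Rightarrow> 'x \<Rightarrow> 'x"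
  cs_nrm :: "'x \<Rightarrow> real"

definition cs_diff :: "'x cspace \<Rightarrow> 'x \<Rightarrow> 'x \<Rightarrow> 'x" where
  "cs_diff X x y = cs_add X x (cs_smult X (-1) y)"

definition unit_ball :: "'x cspace \<Rightarrow> 'x set" where
  "unit_ball X = {x \<in> cs_carrier X. cs_nrm X x \<le> 1}"

definition unit_sphere :: "'x cspace \<Rightarrow> 'x set" where
  "unit_sphere X = {x \<in> cs_carrier X. cs_nrm X x = 1}"

definition dim_ge_two :: "'x cspace \<Rightarrow> bool" where
  "dim_ge_two X \<longleftrightarrow>
     (\<exists>x \<in> cs_carrier X. \<exists>y \<in> cs_carrier X. \<forall>a b.
        cs_add X (cs_smult X a x) (cs_smult X b y) = cs_zero X \<longrightarrow> a = 0 \<and> b = 0)"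

definition cspace_of :: "'y::complex_banach itself \<Rightarrow> 'y cspace" where
  "cspace_of _ = \<lparr>cs_carrier = UNIV, cs_zero = 0, cs_add = (+), cs_smult = (*\<^sub>C), cs_nrm = norm\<rparr>"


section \<open>Operators\<close>

text \<open>
  Values of an operator outside the carrier are arbitrary; all notions below depend only on the
  values on the carrier.
\<close>

definition bounded_ops :: "'x cspace \<Rightarrow> ('x \<Rightarrow> 'y::complex_banach) set" where
  "bounded_ops X = {T.
     (\<forall>x \<in> cs_carrier X. \<forall>y \<in> cs_carrier X. T (cs_add X x y) = T x + T y) \<and>
     (\<forall>a. \<forall>x \<in> cs_carrier X. T (cs_smult X a x) = a *\<^sub>C T x) \<and>
     (\<exists>K. \<forall>x \<in> cs_carrier X. norm (T x) \<le> K * cs_nrm X x)}"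

definition compact_ops :: "'x cspace \<Rightarrow> ('x \<Rightarrow> 'y::complex_banach) set" where
  "compact_ops X = {T \<in> bounded_ops X. compact (closure (T ` unit_ball X))}"

definition opnorm :: "'x cspace \<Rightarrow> ('x \<Rightarrow> 'y::complex_banach) \<Rightarrow> real" where
  "opnorm X T = (SUP x \<in> unit_ball X. norm (T x))"

definition RSE :: "'x cspace \<Rightarrow> ('x \<Rightarrow> 'y::complex_banach) set" where
  "RSE X = {T \<in> bounded_ops X. \<exists>x0 \<in> unit_sphere X. \<forall>x :: nat \<Rightarrow> 'x.
     (\<forall>n. x n \<in> unit_ball X) \<and> (\<lambda>n. norm (T (x n))) \<longlonglongrightarrow> opnorm X T \<longrightarrow>
     (\<exists>\<sigma> c. strict_mono \<sigma> \<and> cmod c = 1 \<and> (\<lambda>n. T (x (\<sigma> n))) \<longlonglongrightarrow> c *\<^sub>C T x0)}"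

text \<open>\<open>M\<close> is meant to be a linear subspace of \<open>bounded_ops X\<close>.\<close>

definition BPBp_RSE :: "'x cspace \<Rightarrow> ('x \<Rightarrow> 'y::complex_banach) set \<Rightarrow> bool" where
  "BPBp_RSE X M \<longleftrightarrow>
     (\<forall>\<epsilon>>0. \<exists>\<eta>. 0 < \<eta> \<and> \<eta> < \<epsilon> \<and>
        (\<forall>T \<in> M. opnorm X T = 1 \<longrightarrow>
          (\<forall>x \<in> unit_sphere X. norm (T x) > 1 - \<eta> \<longrightarrow>
            (\<exists>S \<in> RSE X \<inter> M. \<exists>x0 \<in> unit_sphere X.
               opnorm X S = 1 \<and> norm (S x0) = 1 \<and>
               opnorm X (\<lambda>z. S z - T z) < \<epsilon> \<and> cs_nrm X (cs_diff X x x0) < \<epsilon>))))"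


section \<open>The space \<open>L\<^sub>\<infinity>(\<mu>)\<close>\<close>

definition ess_norm :: "'a measure \<Rightarrow> ('a \<Rightarrow> complex) \<Rightarrow> ennreal" where
  "ess_norm \<mu> f = esssup \<mu> (\<lambda>t. ennreal (cmod (f t)))"

definition ess_bounded :: "'a measure \<Rightarrow> ('a \<Rightarrow> complex) set" where
  "ess_bounded \<mu> = {f \<in> borel_measurable \<mu>. ess_norm \<mu> f < \<infinity>}"

definition ae_class :: "'a measure \<Rightarrow> ('a \<Rightarrow> complex) \<Rightarrow> ('a \<Rightarrow> complex) set" where
  "ae_class \<mu> f = {g \<in> borel_measurable \<mu>. AE t in \<mu>. g t = f t}"

definition ae_rep :: "('a \<Rightarrow> complex) set \<Rightarrow> 'a \<Rightarrow> complex" where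
  "ae_rep A = (SOME f. f \<in> A)"

definition Linf :: "'a measure \<Rightarrow> ('a \<Rightarrow> complex) set cspace" where
  "Linf \<mu> = \<lparr>
     cs_carrier = ae_class \<mu> ` ess_bounded \<mu>,
     cs_zero = ae_class \<mu> (\<lambda>_. 0),
     cs_add = (\<lambda>A B. ae_class \<mu> (\<lambda>t. ae_rep A t + ae_rep B t)),
     cs_smult = (\<lambda>c A. ae_class \<mu> (\<lambda>t. c * ae_rep A t)),
     cs_nrm = (\<lambda>A. enn2real (ess_norm \<mu> (ae_rep A)))\<rparr>"

text \<open>The operations of \<open>Linf\<close> do not depend on the chosen representatives.\<close>

lemma ae_class_eq_iff:
  assumes "f \<in> borel_measurable \<mu>" "g \<in> borel_measurable \<mu>"
  shows "ae_class \<mu> f = ae_class \<mu> g \<longleftrightarrow> (AE t in \<mu>. f t = g t)"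
proof
  assume "ae_class \<mu> f = ae_class \<mu> g"
  moreover have "f \<in> ae_class \<mu> f"
    using assms by (simp add: ae_class_def)
  ultimately show "AE t in \<mu>. f t = g t"
    by (simp add: ae_class_def)
next
  assume *: "AE t in \<mu>. f t = g t"
  have "(AE t in \<mu>. h t = f t) \<longleftrightarrow> (AE t in \<mu>. h t = g t)" for h
    by (rule eventually_subst) (use * in eventually_elim, simp)
  then show "ae_class \<mu> f = ae_class \<mu> g"
    by (simp add: ae_class_def)
qed

lemma rep_ae_class:
  assumes "f \<in> borel_measurable \<mu>"
  shows "ae_rep (ae_class \<mu> f) \<in> borel_measurable \<mu>" "AE t in \<mu>. ae_rep (ae_class \<mu> f) t = f t"
proof -
  have "f \<in> ae_class \<mu> f"
    using assms by (simp add: ae_class_def)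
  then have "ae_rep (ae_class \<mu> f) \<in> ae_class \<mu> f"
    unfolding ae_rep_def by (rule someI[where P = "\<lambda>h. h \<in> ae_class \<mu> f"])
  then show "ae_rep (ae_class \<mu> f) \<in> borel_measurable \<mu>" "AE t in \<mu>. ae_rep (ae_class \<mu> f) t = f t"
    by (simp_all add: ae_class_def)
qed

lemma Linf_add:
  assumes [measurable]: "f \<in> borel_measurable \<mu>" "g \<in> borel_measurable \<mu>"
  shows "cs_add (Linf \<mu>) (ae_class \<mu> f) (ae_class \<mu> g) = ae_class \<mu> (\<lambda>t. f t + g t)"
proof -
  note [measurable] = rep_ae_class(1)[OF assms(1)] rep_ae_class(1)[OF assms(2)]
  have "AE t in \<mu>. ae_rep (ae_class \<mu> f) t + ae_rep (ae_class \<mu> g) t = f t + g t"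
    using rep_ae_class(2)[OF assms(1)] rep_ae_class(2)[OF assms(2)] by eventually_elim simp
  then show ?thesis
    by (simp add: Linf_def ae_class_eq_iff)
qed

lemma Linf_smult:
  assumes [measurable]: "f \<in> borel_measurable \<mu>"
  shows "cs_smult (Linf \<mu>) c (ae_class \<mu> f) = ae_class \<mu> (\<lambda>t. c * f t)"
proof -
  note [measurable] = rep_ae_class(1)[OF assms]
  have "AE t in \<mu>. c * ae_rep (ae_class \<mu> f) t = c * f t"
    using rep_ae_class(2)[OF assms] by eventually_elim simp
  then show ?thesis
    by (simp add: Linf_def ae_class_eq_iff)
qed

lemma Linf_nrm:
  assumes [measurable]: "f \<in> borel_measurable \<mu>"
  shows "cs_nrm (Linf \<mu>) (ae_class \<mu> f) = enn2real (ess_norm \<mu> f)"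
proof -
  note [measurable] = rep_ae_class(1)[OF assms]
  have "AE t in \<mu>. ennreal (cmod (ae_rep (ae_class \<mu> f) t)) = ennreal (cmod (f t))"
    using rep_ae_class(2)[OF assms] by eventually_elim simp
  then have "ess_norm \<mu> (ae_rep (ae_class \<mu> f)) = ess_norm \<mu> f"
    unfolding ess_norm_def by (intro esssup_AE_cong) auto
  then show ?thesis
    by (simp add: Linf_def)
qed

end

theory Submission
  imports Defs
begin

text \<open>
  An operator is handled through its composition with the map sending a function to its class, so
  that it becomes a linear map \<open>G\<close> on essentially bounded functions with
  \<open>norm (G f) \<le> K * c\<close> whenever \<open>cmod f \<le> c\<close> almost everywhere.

  Suppose that \<open>Y\<close> is \<open>\<complex>\<close>-uniformly convex. If \<open>G\<close> is a contraction and \<open>g\<close>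
  almost norms it, then \<open>G\<close> is small on every \<open>h\<close> with \<open>cmod g + cmod h \<le> 1\<close>,
  because \<open>G g + w G h\<close> stays in the unit ball for all unimodular \<open>w\<close>
  (\<open>small_on_slack_of_near_norming\<close>). Apply this with \<open>g = (1 + f) / 2\<close>: if \<open>1\<close> and
  \<open>f\<close> almost norm \<open>G\<close> in a common direction, then \<open>G\<close> nearly vanishes where \<open>f\<close> is far
  from \<open>1\<close>, so \<open>G (f h)\<close> is close to \<open>G h\<close> uniformly in the unit ball
  (\<open>multiplier_near_identity\<close>). Everything else is a perturbation by a rank one operator
  \<open>d \<phi>(G f) v\<close> with \<open>v = G 1\<close> and \<open>\<phi>\<close> a functional norming \<open>v\<close>; it forces
  near-maximizers \<open>f\<close>, after a rotation, to satisfy \<open>\<phi>(G f)\<close> close to \<open>1\<close>.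

  The perturbed operator \<open>T\<close> need not attain its norm. Take near-maximizers \<open>z\<^sub>n\<close> of \<open>T\<close>
  and let \<open>S f\<close> be the limit of \<open>T (z\<^sub>n f)\<close> along an ultrafilter on the naturals; it exists
  because \<open>T\<close> is compact. Then \<open>S\<close> attains its norm, which is that of \<open>T\<close>, at the constant
  \<open>1\<close>, and it is close to \<open>T\<close> since multiplying by \<open>z\<^sub>n\<close> hardly matters
  (\<open>perturb_to_attain_at_one\<close>). A second perturbation of the same kind turns attainment into range
  strong exposition: now \<open>\<phi>(G f\<^sub>n)\<close> tends to \<open>1\<close>, hence \<open>G (f\<^sub>n - 1)\<close> tends to \<open>0\<close>
  (\<open>perturb_to_exposing_at_one\<close>). A general near-norming \<open>u\<close> is reduced to the constant \<open>1\<close>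
  by dividing by its phase on the set where \<open>cmod u\<close> is close to \<open>1\<close> and dropping the
  rest, on which the operator is small (\<open>bpb_rse_ess_operator\<close>).

  Conversely, suppose that \<open>Y\<close> is not \<open>\<complex>\<close>-uniformly convex, with witnesses \<open>y\<^sub>0, y\<^sub>1\<close>.
  As the space is at least two-dimensional, some measurable \<open>A\<close> and its complement are both non-null.
  Limits along ultrafilters that concentrate on \<open>A\<close> and on its complement give functionals
  \<open>\<phi>, \<psi>\<close>, and \<open>\<phi> y\<^sub>0 + \<psi> y\<^sub>1\<close>, once normalized, is a compact operator almost normed by
  the indicator of \<open>A\<close>. A range strongly exposing \<open>S\<close> that attains its norm near that indicator
  must vanish on functions supported off \<open>A\<close>: all norming vectors of \<open>S\<close> are mapped to one
  circle, and a circle contains no proper segment (\<open>RSE_kills_small_support\<close>). Hence \<open>S\<close> is far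
  from an operator that takes the indicator of the complement to a multiple of \<open>y\<^sub>1\<close>.
\<close>

section \<open>Minimal elements and ultrafilters\<close>

text \<open>
  Zorn's lemma downwards, in the form used for filters below and for sublinear functionals later.
\<close>

lemma exists_minimal:
  fixes A :: "'a::order set"
  assumes ne: "A \<noteq> {}"
    and ch: "\<And>C. C \<noteq> {} \<Longrightarrow> C \<subseteq> A \<Longrightarrow> \<forall>a\<in>C. \<forall>b\<in>C. a \<le> b \<or> b \<le> a \<Longrightarrow> \<exists>u\<in>A. \<forall>a\<in>C. u \<le> a"
  shows "\<exists>m\<in>A. \<forall>a\<in>A. a \<le> m \<longrightarrow> a = m"
proof (rule predicate_Zorn)
  show "partial_order_on A (relation_of (\<lambda>x y. y \<le> x) A)"
    by (rule partial_order_on_relation_ofI) auto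
  fix C assume C: "C \<in> Chains (relation_of (\<lambda>x y. y \<le> x) A)"
  show "\<exists>u\<in>A. \<forall>a\<in>C. u \<le> a"
  proof (cases "C = {}")
    case True
    then show ?thesis using ne by auto
  next
    case False
    show ?thesis
      by (rule ch[OF False]) (use C in \<open>auto simp: Chains_def relation_of_def\<close>)
  qed
qed

definition is_ultrafilter :: "'a filter \<Rightarrow> bool" where
  "is_ultrafilter U \<longleftrightarrow> U \<noteq> bot \<and> (\<forall>P. eventually P U \<or> eventually (\<lambda>x. \<not> P x) U)"

lemma ultrafilter_refinement:
  assumes "F \<noteq> bot"
  obtains U where "is_ultrafilter U" "U \<le> F"
proof -
  have "\<exists>m\<in>{G. G \<noteq> bot \<and> G \<le> F}. \<forall>a\<in>{G. G \<noteq> bot \<and> G \<le> F}. a \<le> m \<longrightarrow> a = m"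
  proof (rule exists_minimal)
    show "{G. G \<noteq> bot \<and> G \<le> F} \<noteq> {}" using assms by auto
    fix C :: "'a filter set"
    assume C: "C \<noteq> {}" "C \<subseteq> {G. G \<noteq> bot \<and> G \<le> F}" "\<forall>a\<in>C. \<forall>b\<in>C. a \<le> b \<or> b \<le> a"
    have "\<exists>x\<in>C. x \<le> inf a b" if "a \<in> C" "b \<in> C" for a b
      using C(3) that by (metis inf.absorb1 inf.absorb2 order_refl)
    then have "eventually P (Inf C) \<longleftrightarrow> (\<exists>b\<in>C. eventually P b)" for P
      using C(1) by (intro eventually_Inf_base) auto
    then have "Inf C \<noteq> bot"
      using C(2) by (auto simp: trivial_limit_def)
    moreover have "Inf C \<le> F"
      using C(1,2) by (metis (mono_tags, lifting) Inf_lower2 ex_in_conv mem_Collect_eq subset_eq)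
    ultimately show "\<exists>u\<in>{G. G \<noteq> bot \<and> G \<le> F}. \<forall>a\<in>C. u \<le> a"
      by (auto intro: Inf_lower)
  qed
  then obtain m where m: "m \<noteq> bot" "m \<le> F" "\<And>a. a \<noteq> bot \<Longrightarrow> a \<le> F \<Longrightarrow> a \<le> m \<Longrightarrow> a = m"
    by blast
  have "eventually P m \<or> eventually (\<lambda>x. \<not> P x) m" for P
  proof (cases "inf m (principal {x. P x}) = bot")
    case True
    then show ?thesis
      by (simp add: trivial_limit_def eventually_inf_principal)
  next
    case False
    then have "inf m (principal {x. P x}) = m"
      using m(2) by (intro m(3)) (auto intro: le_infI1)
    then have "eventually P (inf m (principal {x. P x})) = eventually P m" by simp
    then show ?thesis by (simp add: eventually_inf_principal)
  qed
  then show ?thesis using m that by (auto simp: is_ultrafilter_def)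
qed

lemma ultrafilter_limit:
  assumes U: "is_ultrafilter U" and K: "compact K" and ev: "eventually (\<lambda>x. f x \<in> K) U"
  obtains l where "l \<in> K" "(f \<longlongrightarrow> l) U"
proof -
  have "filtermap f U \<noteq> bot" using U by (simp add: is_ultrafilter_def filtermap_bot_iff)
  moreover have "eventually (\<lambda>y. y \<in> K) (filtermap f U)" using ev by (simp add: eventually_filtermap)
  ultimately obtain l where l: "l \<in> K" "inf (nhds l) (filtermap f U) \<noteq> bot"
    using K unfolding compact_filter by blast
  have "eventually (\<lambda>x. f x \<in> S) U" if S: "open S" "l \<in> S" for S
  proof (rule ccontr)
    assume "\<not> ?thesis"
    then have "eventually (\<lambda>x. f x \<notin> S) U" using U by (auto simp: is_ultrafilter_def)
    then have "eventually (\<lambda>y. y \<notin> S) (filtermap f U)" by (simp add: eventually_filtermap)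
    moreover have "eventually (\<lambda>y. y \<in> S) (nhds l)" using S by (auto simp: eventually_nhds)
    ultimately have "eventually (\<lambda>_. False) (inf (nhds l) (filtermap f U))"
      unfolding eventually_inf by (intro exI[of _ "\<lambda>y. y \<in> S"] exI[of _ "\<lambda>y. y \<notin> S"]) auto
    then show False using l(2) by (simp add: trivial_limit_def)
  qed
  then have "(f \<longlongrightarrow> l) U" by (simp add: tendsto_def)
  with l(1) show ?thesis by (rule that)
qed

section \<open>Complex scalars and norming functionals\<close>

lemma bounded_bilinear_scaleC: "bounded_bilinear (scaleC :: complex \<Rightarrow> 'y::complex_banach \<Rightarrow> 'y)"
proof
  fix r :: real and a :: complex and b :: 'y
  show "(r *\<^sub>R a) *\<^sub>C b = r *\<^sub>R (a *\<^sub>C b)"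
    by (simp add: scaleC_of_real[symmetric] scaleC_scaleC scaleR_conv_of_real)
  show "a *\<^sub>C (r *\<^sub>R b) = r *\<^sub>R (a *\<^sub>C b)"
    by (simp add: scaleC_of_real[symmetric] scaleC_scaleC mult.commute)
  show "\<exists>K. \<forall>(a::complex) (b::'y). norm (a *\<^sub>C b) \<le> norm a * norm b * K"
    by (rule exI[of _ 1]) (simp add: norm_scaleC)
qed (simp_all add: scaleC_add_left scaleC_add_right)

lemmas tendsto_scaleC [tendsto_intros] = bounded_bilinear.tendsto[OF bounded_bilinear_scaleC]
lemmas continuous_on_scaleC [continuous_intros] = bounded_bilinear.continuous_on[OF bounded_bilinear_scaleC]
lemmas scaleC_zero_left [simp] = bounded_bilinear.zero_left[OF bounded_bilinear_scaleC]
lemmas scaleC_zero_right [simp] = bounded_bilinear.zero_right[OF bounded_bilinear_scaleC]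
lemmas scaleC_diff_left = bounded_bilinear.diff_left[OF bounded_bilinear_scaleC]
lemmas scaleC_diff_right = bounded_bilinear.diff_right[OF bounded_bilinear_scaleC]
lemmas scaleC_minus_left = bounded_bilinear.minus_left[OF bounded_bilinear_scaleC]

lemma scaleC_one [simp]: "1 *\<^sub>C (y::'y::complex_banach) = y"
  using scaleC_of_real[of 1 y] by simp

lemma unimodular_rotation:
  obtains c where "cmod c = 1" "c * z = complex_of_real (cmod z)"
proof (cases "z = 0")
  case True
  then show ?thesis using that[of 1] by simp
next
  case False
  show ?thesis
  proof (rule that[of "cnj (sgn z)"])
    show "cmod (cnj (sgn z)) = 1" using False by (simp add: norm_sgn)
    have "z * cnj z / complex_of_real (cmod z) = complex_of_real (cmod z)"
      using False by (simp add: complex_norm_square[symmetric] power2_eq_square)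
    then show "cnj (sgn z) * z = complex_of_real (cmod z)"
      by (simp add: sgn_eq mult.commute)
  qed
qed

definition sublinear :: "('v::real_vector \<Rightarrow> real) \<Rightarrow> bool" where
  "sublinear p \<longleftrightarrow> (\<forall>x y. p (x + y) \<le> p x + p y) \<and> (\<forall>r\<ge>0. \<forall>x. p (r *\<^sub>R x) = r * p x)"

lemma sublinear_0: "sublinear p \<Longrightarrow> p 0 = 0"
  unfolding sublinear_def by (metis mult_zero_left order_refl scaleR_zero_left)

lemma sublinear_lower:
  assumes "sublinear p"
  shows "- p (- x) \<le> p x"
proof -
  have "p (x + - x) \<le> p x + p (- x)" using assms unfolding sublinear_def by blast
  then show ?thesis using sublinear_0[OF assms] by simp
qed

text \<open>
  The functional \<open>q x = INF t \<ge> 0. p (x + t y) - t p y\<close> is sublinear, and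
  the last property makes it additive in the direction \<open>y\<close>. It serves twice: with \<open>x = - y\<close> and
  \<open>t = 1\<close> it gives \<open>q (- y) \<le> - p y\<close>, so that linear functionals below \<open>q\<close> are at least
  \<open>p y\<close> at \<open>y\<close>; and it shows that minimal sublinear functionals are additive.
\<close>

lemma sublinear_directional:
  assumes p: "sublinear p"
  obtains q where "sublinear q" "q \<le> p" "\<And>t x. 0 \<le> t \<Longrightarrow> q x \<le> p (x + t *\<^sub>R y) - t * p y"
proof -
  define h where "h x t = p (x + t *\<^sub>R y) - t * p y" for x t
  define q where "q x = (INF t\<in>{0..}. h x t)" for x
  have add: "p (u + v) \<le> p u + p v" for u v using p by (simp add: sublinear_def)
  have hom: "r \<ge> 0 \<Longrightarrow> p (r *\<^sub>R u) = r * p u" for r u using p by (simp add: sublinear_def)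
  have lb: "- p (- x) \<le> h x t" if "t \<ge> 0" for x t
    using add[of "x + t *\<^sub>R y" "- x"] hom[OF that, of y] by (simp add: h_def)
  have bdd: "bdd_below (h x ` {0..})" for x
    by (rule bdd_belowI2[where m = "- p (- x)"]) (use lb in auto)
  have le: "q x \<le> h x t" if "t \<ge> 0" for x t
    unfolding q_def by (rule cINF_lower[OF bdd]) (use that in auto)
  have gr: "c \<le> q x" if "\<And>t. t \<ge> 0 \<Longrightarrow> c \<le> h x t" for c x
    unfolding q_def by (rule cINF_greatest) (use that in auto)
  have "q (a + b) \<le> q a + q b" for a b
  proof -
    have "q (a + b) \<le> h a s + h b t" if "s \<ge> 0" "t \<ge> 0" for s t
    proof -
      have "q (a + b) \<le> h (a + b) (s + t)" using that by (intro le) auto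
      also have "\<dots> \<le> h a s + h b t"
        using add[of "a + s *\<^sub>R y" "b + t *\<^sub>R y"] by (simp add: h_def algebra_simps)
      finally show ?thesis .
    qed
    then have "q (a + b) - h a s \<le> q b" if "s \<ge> 0" for s
      using that by (intro gr) (simp add: algebra_simps)
    then have "q (a + b) - q b \<le> q a"
      by (intro gr) (simp add: algebra_simps)
    then show ?thesis by simp
  qed
  moreover have "q (r *\<^sub>R x) = r * q x" if r: "r \<ge> 0" for r x
  proof (cases "r = 0")
    case True
    have "h 0 t = 0" if "t \<ge> 0" for t using hom[OF that] by (simp add: h_def)
    then have "q 0 = 0"
      using le[of 0 0] gr[of 0 0] by (intro antisym) auto
    then show ?thesis using True by simp
  next
    case False
    with r have r: "r > 0" by simp
    have sc: "h (r *\<^sub>R x) (r * t) = r * h x t" if "r > 0" for r x t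
      using that hom[of r "x + t *\<^sub>R y"] by (simp add: h_def algebra_simps)
    have half: "q (r *\<^sub>R x) \<le> r * q x" if r: "r > 0" for r x
    proof -
      have "q (r *\<^sub>R x) / r \<le> q x"
      proof (rule gr)
        fix t :: real assume "t \<ge> 0"
        then have "q (r *\<^sub>R x) \<le> r * h x t" using le[of "r * t" "r *\<^sub>R x"] sc[OF r] r by simp
        then show "q (r *\<^sub>R x) / r \<le> h x t" using r by (simp add: field_simps)
      qed
      then show ?thesis using r by (simp add: field_simps)
    qed
    have "q ((1 / r) *\<^sub>R (r *\<^sub>R x)) \<le> (1 / r) * q (r *\<^sub>R x)" using r by (intro half) simp
    then have "r * q x \<le> q (r *\<^sub>R x)" using r by (simp add: field_simps)
    with half[OF r] show ?thesis by (rule antisym)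
  qed
  ultimately have "sublinear q" by (simp add: sublinear_def)
  moreover have "q \<le> p" using le[of 0] by (auto simp: le_fun_def h_def)
  ultimately show ?thesis using le by (intro that) (auto simp: h_def)
qed

text \<open>
  The Hahn-Banach theorem: a minimal sublinear functional below \<open>p\<close> coincides with its own
  modification in every direction and is therefore additive.
\<close>

lemma dominated_linear_exists:
  assumes p: "sublinear p"
  obtains q where "linear q" "q \<le> p"
proof -
  have "\<exists>m\<in>{q. sublinear q \<and> q \<le> p}. \<forall>a\<in>{q. sublinear q \<and> q \<le> p}. a \<le> m \<longrightarrow> a = m"
  proof (rule exists_minimal)
    show "{q. sublinear q \<and> q \<le> p} \<noteq> {}" using p by auto
    fix C assume C: "C \<noteq> {}" "C \<subseteq> {q. sublinear q \<and> q \<le> p}" "\<forall>a\<in>C. \<forall>b\<in>C. a \<le> b \<or> b \<le> a"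
    define u where "u x = (INF q\<in>C. q x)" for x
    have sub: "sublinear q" "q \<le> p" if "q \<in> C" for q using that C(2) by auto
    have bdd: "bdd_below ((\<lambda>q. q x) ` C)" for x
    proof (rule bdd_belowI2[where m = "- p (- x)"])
      fix q assume "q \<in> C"
      then show "- p (- x) \<le> q x"
        using sublinear_lower[OF sub(1), of q x] sub(2)[of q] by (force simp: le_fun_def dest: spec[of _ "- x"])
    qed
    have le: "u x \<le> q x" if "q \<in> C" for q x unfolding u_def by (rule cINF_lower[OF bdd that])
    have gr: "c \<le> u x" if "\<And>q. q \<in> C \<Longrightarrow> c \<le> q x" for c x
      unfolding u_def by (rule cINF_greatest[OF C(1)]) (use that in auto)
    have "u (x + y) \<le> u x + u y" for x y
    proof -
      have *: "u (x + y) \<le> q x + r y" if qr: "q \<in> C" "r \<in> C" for q r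
      proof -
        obtain s where s: "s \<in> C" "s \<le> q" "s \<le> r" using C(3) qr by (metis order_refl)
        have "u (x + y) \<le> s (x + y)" by (rule le[OF s(1)])
        also have "\<dots> \<le> s x + s y" using sub(1)[OF s(1)] by (simp add: sublinear_def)
        also have "\<dots> \<le> q x + r y" using s(2,3) by (intro add_mono) (auto simp: le_fun_def)
        finally show ?thesis .
      qed
      have "u (x + y) - q x \<le> u y" if "q \<in> C" for q
        using *[OF that] by (intro gr) (simp add: algebra_simps)
      then have "u (x + y) - u y \<le> u x" by (intro gr) (simp add: algebra_simps)
      then show ?thesis by simp
    qed
    moreover have "u (r *\<^sub>R x) = r * u x" if r: "r \<ge> 0" for r x
    proof (cases "r = 0")
      case True
      have "(\<lambda>q. q (0 :: 'a)) ` C = (\<lambda>q. 0) ` C" using sublinear_0[OF sub(1)] by (intro image_cong) auto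
      then have "(\<lambda>q. q (0 :: 'a)) ` C = {0}" using C(1) by auto
      then show ?thesis using True by (simp add: u_def)
    next
      case False
      with r have r: "r > 0" by simp
      have hom: "q (r *\<^sub>R x) = r * q x" if "q \<in> C" for q using sub(1)[OF that] r by (simp add: sublinear_def)
      have "u (r *\<^sub>R x) / r \<le> u x"
        by (rule gr) (use le[of _ "r *\<^sub>R x"] hom r in \<open>simp add: field_simps\<close>)
      moreover have "r * u x \<le> u (r *\<^sub>R x)"
      proof (rule gr)
        fix q assume q: "q \<in> C"
        show "r * u x \<le> q (r *\<^sub>R x)" using le[OF q, of x] hom[OF q] r by simp
      qed
      ultimately show ?thesis using r by (simp add: field_simps)
    qed
    ultimately have "sublinear u" by (simp add: sublinear_def)
    moreover have "u \<le> p"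
    proof -
      obtain q where "q \<in> C" using C(1) by auto
      then show ?thesis using le sub(2) by (meson le_fun_def order_trans)
    qed
    ultimately show "\<exists>u\<in>{q. sublinear q \<and> q \<le> p}. \<forall>a\<in>C. u \<le> a"
      using le by (intro bexI[of _ u]) (auto simp: le_fun_def)
  qed
  then obtain q where q: "sublinear q" "q \<le> p"
    and min: "\<And>r. sublinear r \<Longrightarrow> r \<le> q \<Longrightarrow> r = q"
    by (auto intro: order_trans)
  have add: "q (x + y) = q x + q y" for x y
  proof (rule antisym)
    show "q (x + y) \<le> q x + q y" using q(1) by (simp add: sublinear_def)
    obtain r where r: "sublinear r" "r \<le> q" "\<And>t x. 0 \<le> t \<Longrightarrow> r x \<le> q (x + t *\<^sub>R y) - t * q y"
      using sublinear_directional[OF q(1)] by blast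
    have "r = q" by (rule min[OF r(1,2)])
    then show "q x + q y \<le> q (x + y)" using r(3)[of 1 x] by simp
  qed
  have neg: "q (- x) = - q x" for x using add[of x "- x"] sublinear_0[OF q(1)] by simp
  have pos: "q (r *\<^sub>R x) = r * q x" if "r \<ge> 0" for r x
    using q(1) that by (simp add: sublinear_def)
  have "q (r *\<^sub>R x) = r * q x" for r x
    using pos[of r x] pos[of "- r" x] neg[of "r *\<^sub>R x"] by (cases "r \<ge> 0") auto
  with add have "linear q" by (intro linearI) auto
  with q(2) show ?thesis by (intro that)
qed

definition norming_functional :: "('y::complex_banach \<Rightarrow> complex) \<Rightarrow> 'y \<Rightarrow> bool" where
  "norming_functional \<phi> y0 \<longleftrightarrow>
     (\<forall>x y. \<phi> (x + y) = \<phi> x + \<phi> y) \<and> (\<forall>a x. \<phi> (a *\<^sub>C x) = a * \<phi> x) \<and>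
     (\<forall>x. cmod (\<phi> x) \<le> norm x) \<and> \<phi> y0 = complex_of_real (norm y0)"

text \<open>
  A real functional dominated by the modification of the norm in the direction \<open>y0\<close> norms
  \<open>y0\<close>; it is complexified as \<open>q y - i q (i y)\<close>.
\<close>

lemma norming_functional_exists:
  fixes y0 :: "'y::complex_banach"
  obtains \<phi> where "norming_functional \<phi> y0"
proof -
  have "sublinear (norm :: 'y \<Rightarrow> real)" by (auto simp: sublinear_def norm_triangle_ineq)
  then obtain p where p: "sublinear p" "p \<le> (norm :: 'y \<Rightarrow> real)"
    "\<And>t x. 0 \<le> t \<Longrightarrow> p x \<le> norm (x + t *\<^sub>R y0) - t * norm y0"
    using sublinear_directional[where y = y0] by blast
  obtain q where q: "linear q" "q \<le> p" by (rule dominated_linear_exists[OF p(1)])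
  have qn: "q x \<le> norm x" for x using q(2) p(2) by (meson le_fun_def order_trans)
  have "q (- y0) \<le> - norm y0"
    using q(2) p(3)[of 1 "- y0"] by (auto simp: le_fun_def intro: order_trans)
  then have qy0: "q y0 = norm y0"
    using qn[of y0] q(1) by (simp add: linear_neg)
  define \<phi> where "\<phi> y = Complex (q y) (- q (\<i> *\<^sub>C y))" for y
  have sc: "q (r *\<^sub>R y) = r * q y" for r y using q(1) by (simp add: linear_scale)
  have ad: "q (x + y) = q x + q y" for x y using q(1) by (simp add: linear_add)
  have add: "\<phi> (x + y) = \<phi> x + \<phi> y" for x y
    by (simp add: \<phi>_def complex_eq_iff scaleC_add_right ad)
  have hom: "\<phi> (a *\<^sub>C x) = a * \<phi> x" for a x
  proof -
    have a: "a *\<^sub>C x = Re a *\<^sub>R x + Im a *\<^sub>R (\<i> *\<^sub>C x)" for x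
    proof -
      have "a *\<^sub>C x = (complex_of_real (Re a) + complex_of_real (Im a) * \<i>) *\<^sub>C x"
        by (metis complex_eq mult.commute)
      also have "\<dots> = Re a *\<^sub>R x + Im a *\<^sub>R (\<i> *\<^sub>C x)"
        by (simp only: scaleC_add_left scaleC_scaleC[symmetric] scaleC_of_real)
      finally show ?thesis .
    qed
    have "\<i> *\<^sub>C \<i> *\<^sub>C x = - x"
      by (simp add: scaleC_scaleC scaleC_minus_left)
    moreover have "\<i> *\<^sub>C (a *\<^sub>C x) = a *\<^sub>C (\<i> *\<^sub>C x)"
      by (simp add: scaleC_scaleC mult.commute)
    ultimately have i: "\<i> *\<^sub>C (a *\<^sub>C x) = Re a *\<^sub>R (\<i> *\<^sub>C x) - Im a *\<^sub>R x"
      using a[of "\<i> *\<^sub>C x"] by simp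
    have neg: "q (x - y) = q x - q y" for x y using q(1) by (simp add: linear_diff)
    show ?thesis unfolding \<phi>_def i by (simp add: complex_eq_iff a[of x] ad neg sc)
  qed
  have bd: "cmod (\<phi> x) \<le> norm x" for x
  proof -
    obtain c where c: "cmod c = 1" "c * \<phi> x = complex_of_real (cmod (\<phi> x))" by (rule unimodular_rotation)
    have "cmod (\<phi> x) = Re (\<phi> (c *\<^sub>C x))" by (simp add: hom c)
    also have "\<dots> = q (c *\<^sub>C x)" by (simp add: \<phi>_def)
    also have "\<dots> \<le> norm x" using qn[of "c *\<^sub>C x"] c by (simp add: norm_scaleC)
    finally show ?thesis .
  qed
  have "Re (\<phi> y0) = norm y0" by (simp add: \<phi>_def qy0)
  moreover have "Im (\<phi> y0) = 0"
  proof -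
    have "(Re (\<phi> y0))\<^sup>2 + (Im (\<phi> y0))\<^sup>2 \<le> (norm y0)\<^sup>2"
      using power_mono[OF bd[of y0] norm_ge_zero, of 2] by (simp add: cmod_power2)
    then show ?thesis using calculation by simp
  qed
  ultimately have "\<phi> y0 = complex_of_real (norm y0)" by (intro complex_eqI) simp_all
  then have "norming_functional \<phi> y0"
    unfolding norming_functional_def by (intro conjI allI add hom bd)
  then show ?thesis by (rule that)
qed

section \<open>Operators as maps on essentially bounded functions\<close>

definition ess_ball :: "'a measure \<Rightarrow> real \<Rightarrow> ('a \<Rightarrow> complex) set" where
  "ess_ball \<mu> c = {f \<in> borel_measurable \<mu>. AE t in \<mu>. cmod (f t) \<le> c}"

lemma ess_ballI: "f \<in> borel_measurable \<mu> \<Longrightarrow> AE t in \<mu>. cmod (f t) \<le> c \<Longrightarrow> f \<in> ess_ball \<mu> c"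
  by (simp add: ess_ball_def)

lemma ess_ball_measurable [measurable_dest]: "f \<in> ess_ball \<mu> c \<Longrightarrow> f \<in> borel_measurable \<mu>"
  by (simp add: ess_ball_def)

lemma ess_ball_AE: "f \<in> ess_ball \<mu> c \<Longrightarrow> AE t in \<mu>. cmod (f t) \<le> c"
  by (simp add: ess_ball_def)

lemma ess_ball_mono: "f \<in> ess_ball \<mu> c \<Longrightarrow> c \<le> d \<Longrightarrow> f \<in> ess_ball \<mu> d"
  unfolding ess_ball_def by (auto elim: eventually_mono)

lemma ess_norm_le_iff:
  assumes "f \<in> borel_measurable \<mu>" "c \<ge> 0"
  shows "ess_norm \<mu> f \<le> ennreal c \<longleftrightarrow> f \<in> ess_ball \<mu> c"
proof
  assume *: "ess_norm \<mu> f \<le> ennreal c"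
  have "AE t in \<mu>. ennreal (cmod (f t)) \<le> ess_norm \<mu> f" unfolding ess_norm_def by (rule esssup_AE)
  then have "AE t in \<mu>. cmod (f t) \<le> c"
  proof eventually_elim
    case (elim t)
    then have "ennreal (cmod (f t)) \<le> ennreal c" using * by (rule order_trans)
    then show ?case using assms(2) by (simp add: ennreal_le_iff)
  qed
  then show "f \<in> ess_ball \<mu> c" using assms(1) by (simp add: ess_ball_def)
next
  assume "f \<in> ess_ball \<mu> c"
  then have "AE t in \<mu>. ennreal (cmod (f t)) \<le> ennreal c"
    by (auto simp: ess_ball_def elim!: eventually_mono intro: ennreal_leI)
  then show "ess_norm \<mu> f \<le> ennreal c"
    unfolding ess_norm_def using assms(1) by (intro esssup_I) auto
qed

lemma ess_bounded_iff: "f \<in> ess_bounded \<mu> \<longleftrightarrow> (\<exists>c\<ge>0. f \<in> ess_ball \<mu> c)"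
proof
  assume f: "f \<in> ess_bounded \<mu>"
  then have "ess_norm \<mu> f = ennreal (enn2real (ess_norm \<mu> f))"
    by (simp add: ess_bounded_def)
  then show "\<exists>c\<ge>0. f \<in> ess_ball \<mu> c"
    using f ess_norm_le_iff[of f \<mu> "enn2real (ess_norm \<mu> f)"]
    by (intro exI[of _ "enn2real (ess_norm \<mu> f)"]) (auto simp: ess_bounded_def)
next
  assume "\<exists>c\<ge>0. f \<in> ess_ball \<mu> c"
  then obtain c where "c \<ge> 0" "f \<in> ess_ball \<mu> c" by auto
  moreover from this have "f \<in> borel_measurable \<mu>" by (simp add: ess_ball_def)
  ultimately have "ess_norm \<mu> f \<le> ennreal c" "f \<in> borel_measurable \<mu>"
    using ess_norm_le_iff[of f \<mu> c] by auto
  then show "f \<in> ess_bounded \<mu>" unfolding ess_bounded_def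
    by (simp add: le_less_trans[OF _ ennreal_less_top])
qed

lemma ess_bounded_measurable [measurable_dest]: "f \<in> ess_bounded \<mu> \<Longrightarrow> f \<in> borel_measurable \<mu>"
  by (simp add: ess_bounded_def)

lemma ess_ball_bounded: "f \<in> ess_ball \<mu> c \<Longrightarrow> f \<in> ess_bounded \<mu>"
  unfolding ess_bounded_iff using ess_ball_mono[of f \<mu> c "max 0 c"] by (intro exI[of _ "max 0 c"]) auto

lemma ess_ball_add: "f \<in> ess_ball \<mu> c \<Longrightarrow> g \<in> ess_ball \<mu> d \<Longrightarrow> (\<lambda>t. f t + g t) \<in> ess_ball \<mu> (c + d)"
proof (rule ess_ballI)
  assume f: "f \<in> ess_ball \<mu> c" and g: "g \<in> ess_ball \<mu> d"
  note [measurable] = ess_ball_measurable[OF f] ess_ball_measurable[OF g]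
  show "(\<lambda>t. f t + g t) \<in> borel_measurable \<mu>" by measurable
  show "AE t in \<mu>. cmod (f t + g t) \<le> c + d"
    using ess_ball_AE[OF f] ess_ball_AE[OF g]
    by eventually_elim (rule order_trans[OF norm_triangle_ineq add_mono])
qed

lemma ess_ball_mult:
  assumes "f \<in> ess_ball \<mu> c" "g \<in> ess_ball \<mu> d" "c \<ge> 0"
  shows "(\<lambda>t. f t * g t) \<in> ess_ball \<mu> (c * d)"
proof (rule ess_ballI)
  note [measurable] = ess_ball_measurable[OF assms(1)] ess_ball_measurable[OF assms(2)]
  show "(\<lambda>t. f t * g t) \<in> borel_measurable \<mu>" by measurable
  show "AE t in \<mu>. cmod (f t * g t) \<le> c * d"
    using ess_ball_AE[OF assms(1)] ess_ball_AE[OF assms(2)]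
    by eventually_elim (use assms(3) in \<open>auto simp: norm_mult intro!: mult_mono\<close>)
qed

lemma ess_ball_const: "cmod a \<le> c \<Longrightarrow> (\<lambda>_. a) \<in> ess_ball \<mu> c"
  by (simp add: ess_ball_def)

lemma ess_ball_cmult: "f \<in> ess_ball \<mu> c \<Longrightarrow> (\<lambda>t. a * f t) \<in> ess_ball \<mu> (cmod a * c)"
  using ess_ball_mult[OF ess_ball_const[of a "cmod a"]] by auto

lemma ess_bounded_add: "f \<in> ess_bounded \<mu> \<Longrightarrow> g \<in> ess_bounded \<mu> \<Longrightarrow> (\<lambda>t. f t + g t) \<in> ess_bounded \<mu>"
proof -
  assume "f \<in> ess_bounded \<mu>" "g \<in> ess_bounded \<mu>"
  then obtain c d where c: "c \<ge> 0" and f: "f \<in> ess_ball \<mu> c" and g: "g \<in> ess_ball \<mu> d"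
    unfolding ess_bounded_iff by blast
  show ?thesis by (rule ess_ball_bounded[OF ess_ball_add[OF f g]])
qed

lemma ess_bounded_mult: "f \<in> ess_bounded \<mu> \<Longrightarrow> g \<in> ess_bounded \<mu> \<Longrightarrow> (\<lambda>t. f t * g t) \<in> ess_bounded \<mu>"
proof -
  assume "f \<in> ess_bounded \<mu>" "g \<in> ess_bounded \<mu>"
  then obtain c d where c: "c \<ge> 0" and f: "f \<in> ess_ball \<mu> c" and g: "g \<in> ess_ball \<mu> d"
    unfolding ess_bounded_iff by blast
  show ?thesis by (rule ess_ball_bounded[OF ess_ball_mult[OF f g c]])
qed

lemma ess_bounded_const: "(\<lambda>_. a) \<in> ess_bounded \<mu>"
  using ess_ball_bounded[OF ess_ball_const[of a "cmod a"]] by auto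

lemma ess_bounded_cmult: "f \<in> ess_bounded \<mu> \<Longrightarrow> (\<lambda>t. a * f t) \<in> ess_bounded \<mu>"
  by (rule ess_bounded_mult[OF ess_bounded_const])

lemma ess_bounded_diff: "f \<in> ess_bounded \<mu> \<Longrightarrow> g \<in> ess_bounded \<mu> \<Longrightarrow> (\<lambda>t. f t - g t) \<in> ess_bounded \<mu>"
  using ess_bounded_add[OF _ ess_bounded_cmult[of g \<mu> "-1"], of f] by simp

text \<open>
  Including \<open>c = 0\<close> in the bound makes \<open>G\<close> insensitive to null sets.
\<close>

definition ess_operator :: "'a measure \<Rightarrow> real \<Rightarrow> (('a \<Rightarrow> complex) \<Rightarrow> 'y::complex_banach) \<Rightarrow> bool" where
  "ess_operator \<mu> K G \<longleftrightarrow>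
     (\<forall>f\<in>ess_bounded \<mu>. \<forall>g\<in>ess_bounded \<mu>. G (\<lambda>t. f t + g t) = G f + G g) \<and>
     (\<forall>a. \<forall>f\<in>ess_bounded \<mu>. G (\<lambda>t. a * f t) = a *\<^sub>C G f) \<and>
     (\<forall>c\<ge>0. \<forall>f\<in>ess_ball \<mu> c. norm (G f) \<le> K * c)"

lemma ess_operator_add:
  "ess_operator \<mu> K G \<Longrightarrow> f \<in> ess_bounded \<mu> \<Longrightarrow> g \<in> ess_bounded \<mu> \<Longrightarrow> G (\<lambda>t. f t + g t) = G f + G g"
  by (simp add: ess_operator_def)

lemma ess_operator_cmult:
  "ess_operator \<mu> K G \<Longrightarrow> f \<in> ess_bounded \<mu> \<Longrightarrow> G (\<lambda>t. a * f t) = a *\<^sub>C G f"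
  by (simp add: ess_operator_def)

lemma ess_operator_bound:
  "ess_operator \<mu> K G \<Longrightarrow> f \<in> ess_ball \<mu> c \<Longrightarrow> c \<ge> 0 \<Longrightarrow> norm (G f) \<le> K * c"
  by (simp add: ess_operator_def)

lemma ess_operator_diff:
  assumes "ess_operator \<mu> K G" "f \<in> ess_bounded \<mu>" "g \<in> ess_bounded \<mu>"
  shows "G (\<lambda>t. f t - g t) = G f - G g"
  using ess_operator_add[OF assms(1,2) ess_bounded_cmult[OF assms(3), of "-1"]]
    ess_operator_cmult[OF assms(1,3), of "-1"] by (simp add: scaleC_minus_left)

lemma ess_operator_cong:
  assumes G: "ess_operator \<mu> K G" and f: "f \<in> ess_bounded \<mu>" and g: "g \<in> ess_bounded \<mu>"
    and eq: "AE t in \<mu>. f t = g t"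
  shows "G f = G g"
proof -
  have "(\<lambda>t. f t - g t) \<in> ess_ball \<mu> 0"
    using ess_bounded_measurable[OF ess_bounded_diff[OF f g]] eq by (auto simp: ess_ball_def)
  then have "norm (G (\<lambda>t. f t - g t)) \<le> K * 0" by (rule ess_operator_bound[OF G]) simp
  then show ?thesis using ess_operator_diff[OF G f g] by simp
qed

text \<open>
  A bound on the unit ball gives the bound for each \<open>c\<close>; the case \<open>c = 0\<close> follows by
  rescaling to radii slightly larger than \<open>c\<close>.
\<close>

lemma ess_operatorI:
  assumes add: "\<And>f g. f \<in> ess_bounded \<mu> \<Longrightarrow> g \<in> ess_bounded \<mu> \<Longrightarrow> G (\<lambda>t. f t + g t) = G f + G g"
    and sc: "\<And>a f. f \<in> ess_bounded \<mu> \<Longrightarrow> G (\<lambda>t. a * f t) = a *\<^sub>C G f"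
    and bd: "\<And>f. f \<in> ess_ball \<mu> 1 \<Longrightarrow> norm (G f) \<le> K"
  shows "ess_operator \<mu> K G"
proof -
  have K: "K \<ge> 0" using bd[OF ess_ball_const[of 0 1]] norm_ge_zero order_trans by (metis norm_zero zero_le_one)
  have "norm (G f) \<le> K * c" if c: "c \<ge> 0" and f: "f \<in> ess_ball \<mu> c" for c f
  proof (rule field_le_epsilon)
    fix d :: real assume d: "d > 0"
    define e where "e = c + d / (K + 1)"
    have "d / (K + 1) > 0" "K * (d / (K + 1)) \<le> d" using d K by (auto simp: field_simps)
    then have e: "e > 0" "e \<ge> c" "K * e \<le> K * c + d"
      using c by (auto simp: e_def distrib_left)
    have "(\<lambda>t. complex_of_real (1 / e) * f t) \<in> ess_ball \<mu> (cmod (complex_of_real (1 / e)) * e)"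
      by (rule ess_ball_cmult[OF ess_ball_mono[OF f e(2)]])
    then have "(\<lambda>t. complex_of_real (1 / e) * f t) \<in> ess_ball \<mu> 1"
      using e(1) by (simp add: norm_divide)
    from bd[OF this] have "norm (G f) / e \<le> K"
      using e(1) unfolding sc[OF ess_ball_bounded[OF f]] by (simp add: norm_scaleC norm_divide)
    then show "norm (G f) \<le> K * c + d" using e(1,3) by (simp add: field_simps)
  qed
  then show ?thesis using add sc by (simp add: ess_operator_def)
qed

lemma Linf_carrier: "cs_carrier (Linf \<mu>) = ae_class \<mu> ` ess_bounded \<mu>"
  by (simp add: Linf_def)

lemma Linf_nrm_le_iff:
  assumes "f \<in> ess_bounded \<mu>" "c \<ge> 0"
  shows "cs_nrm (Linf \<mu>) (ae_class \<mu> f) \<le> c \<longleftrightarrow> f \<in> ess_ball \<mu> c"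
proof -
  have m: "f \<in> borel_measurable \<mu>" and fin: "ess_norm \<mu> f < \<infinity>" using assms by (auto simp: ess_bounded_def)
  show ?thesis
    unfolding Linf_nrm[OF m] ess_norm_le_iff[OF m assms(2), symmetric]
    using fin assms(2) by (cases "ess_norm \<mu> f") auto
qed

lemma Linf_nrm_nonneg: "f \<in> ess_bounded \<mu> \<Longrightarrow> cs_nrm (Linf \<mu>) (ae_class \<mu> f) \<ge> 0"
  by (simp add: Linf_nrm ess_bounded_measurable)

lemma unit_ball_Linf: "unit_ball (Linf \<mu>) = ae_class \<mu> ` ess_ball \<mu> 1"
  unfolding unit_ball_def Linf_carrier using Linf_nrm_le_iff[of _ \<mu> 1] ess_ball_bounded by auto

lemma bounded_ops_iff: "T \<in> bounded_ops (Linf \<mu>) \<longleftrightarrow> (\<exists>K. ess_operator \<mu> K (\<lambda>f. T (ae_class \<mu> f)))"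
proof
  assume T: "T \<in> bounded_ops (Linf \<mu>)"
  then obtain K where K: "\<And>x. x \<in> cs_carrier (Linf \<mu>) \<Longrightarrow> norm (T x) \<le> K * cs_nrm (Linf \<mu>) x"
    unfolding bounded_ops_def by blast
  have add: "T (ae_class \<mu> (\<lambda>t. f t + g t)) = T (ae_class \<mu> f) + T (ae_class \<mu> g)"
    if "f \<in> ess_bounded \<mu>" "g \<in> ess_bounded \<mu>" for f g
    using T that unfolding bounded_ops_def Linf_carrier
    by (auto simp: Linf_add[symmetric] ess_bounded_measurable)
  have sc: "T (ae_class \<mu> (\<lambda>t. a * f t)) = a *\<^sub>C T (ae_class \<mu> f)" if "f \<in> ess_bounded \<mu>" for f a
    using T that unfolding bounded_ops_def Linf_carrier
    by (auto simp: Linf_smult[symmetric] ess_bounded_measurable)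
  have "norm (T (ae_class \<mu> f)) \<le> max 0 K" if f: "f \<in> ess_ball \<mu> 1" for f
  proof -
    have f': "f \<in> ess_bounded \<mu>" by (rule ess_ball_bounded[OF f])
    then have "norm (T (ae_class \<mu> f)) \<le> K * cs_nrm (Linf \<mu>) (ae_class \<mu> f)"
      by (intro K) (auto simp: Linf_carrier)
    also have "\<dots> \<le> max 0 K * 1"
      using Linf_nrm_nonneg[OF f'] Linf_nrm_le_iff[OF f', of 1] f by (intro mult_mono) auto
    finally show ?thesis by simp
  qed
  then show "\<exists>K. ess_operator \<mu> K (\<lambda>f. T (ae_class \<mu> f))"
    using ess_operatorI[of \<mu> "\<lambda>f. T (ae_class \<mu> f)", OF add sc] by blast
next
  assume "\<exists>K. ess_operator \<mu> K (\<lambda>f. T (ae_class \<mu> f))"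
  then obtain K where K: "ess_operator \<mu> K (\<lambda>f. T (ae_class \<mu> f))" by auto
  have bd: "norm (T (ae_class \<mu> f)) \<le> K * cs_nrm (Linf \<mu>) (ae_class \<mu> f)" if f: "f \<in> ess_bounded \<mu>" for f
    using ess_operator_bound[OF K _ Linf_nrm_nonneg[OF f], of f]
      Linf_nrm_le_iff[OF f Linf_nrm_nonneg[OF f]] by simp
  show "T \<in> bounded_ops (Linf \<mu>)"
    unfolding bounded_ops_def Linf_carrier
    using bd ess_operator_add[OF K] ess_operator_cmult[OF K]
    by (auto simp: Linf_add Linf_smult ess_bounded_measurable)
qed

lemma opnorm_Linf: "opnorm (Linf \<mu>) T = (SUP f\<in>ess_ball \<mu> 1. norm (T (ae_class \<mu> f)))"
  by (simp add: opnorm_def unit_ball_Linf image_image)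

lemma opnorm_least:
  assumes "\<And>f. f \<in> ess_ball \<mu> 1 \<Longrightarrow> norm (T (ae_class \<mu> f)) \<le> c"
  shows "opnorm (Linf \<mu>) T \<le> c"
  unfolding opnorm_Linf using assms ess_ball_const[of 0 1] by (intro cSUP_least) auto

lemma opnorm_upper:
  assumes "T \<in> bounded_ops (Linf \<mu>)" "f \<in> ess_ball \<mu> 1"
  shows "norm (T (ae_class \<mu> f)) \<le> opnorm (Linf \<mu>) T"
proof -
  obtain K where K: "ess_operator \<mu> K (\<lambda>f. T (ae_class \<mu> f))" using assms(1) bounded_ops_iff by blast
  then show ?thesis
    unfolding opnorm_Linf using ess_operator_bound[OF K, of _ 1] assms(2)
    by (intro cSUP_upper bdd_aboveI2[where M = "K * 1"]) auto
qed

lemma ess_operator_opnorm: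
  assumes "T \<in> bounded_ops (Linf \<mu>)"
  shows "ess_operator \<mu> (opnorm (Linf \<mu>) T) (\<lambda>f. T (ae_class \<mu> f))"
proof -
  obtain K where K: "ess_operator \<mu> K (\<lambda>f. T (ae_class \<mu> f))" using assms bounded_ops_iff by blast
  show ?thesis
    by (rule ess_operatorI) (use ess_operator_add[OF K] ess_operator_cmult[OF K] opnorm_upper[OF assms] in auto)
qed

lemma ess_operator_ae_rep:
  assumes G: "ess_operator \<mu> K G" and f: "f \<in> ess_bounded \<mu>"
  shows "G (ae_rep (ae_class \<mu> f)) = G f"
proof (rule ess_operator_cong[OF G _ f])
  have m: "f \<in> borel_measurable \<mu>" using f by (rule ess_bounded_measurable)
  show ae: "AE t in \<mu>. ae_rep (ae_class \<mu> f) t = f t" by (rule rep_ae_class(2)[OF m])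
  obtain c where c: "c \<ge> 0" "f \<in> ess_ball \<mu> c" using f ess_bounded_iff by blast
  have "AE t in \<mu>. cmod (ae_rep (ae_class \<mu> f) t) \<le> c"
    using ae ess_ball_AE[OF c(2)] by eventually_elim simp
  then show "ae_rep (ae_class \<mu> f) \<in> ess_bounded \<mu>"
    using rep_ae_class(1)[OF m] by (intro ess_ball_bounded[of _ _ c]) (simp add: ess_ball_def)
qed

lemma compact_ops_Linf:
  "T \<in> compact_ops (Linf \<mu>) \<longleftrightarrow>
     T \<in> bounded_ops (Linf \<mu>) \<and> compact (closure ((\<lambda>f. T (ae_class \<mu> f)) ` ess_ball \<mu> 1))"
  by (simp add: compact_ops_def unit_ball_Linf image_image)

text \<open>
  Passage back from functions to classes.
\<close>

lemma ess_operator_lift: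
  assumes G: "ess_operator \<mu> K G" and T: "T = (\<lambda>A. G (ae_rep A))"
  shows "T \<in> bounded_ops (Linf \<mu>)"
    and "f \<in> ess_bounded \<mu> \<Longrightarrow> T (ae_class \<mu> f) = G f"
    and "compact (closure (G ` ess_ball \<mu> 1)) \<Longrightarrow> T \<in> compact_ops (Linf \<mu>)"
proof -
  have eq: "T (ae_class \<mu> f) = G f" if "f \<in> ess_bounded \<mu>" for f
    unfolding T by (rule ess_operator_ae_rep[OF G that])
  then show "f \<in> ess_bounded \<mu> \<Longrightarrow> T (ae_class \<mu> f) = G f" .
  have "ess_operator \<mu> K (\<lambda>f. T (ae_class \<mu> f))"
  proof (rule ess_operatorI)
    fix f :: "'a \<Rightarrow> complex" assume "f \<in> ess_ball \<mu> 1"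
    then show "norm (T (ae_class \<mu> f)) \<le> K"
      using ess_operator_bound[OF G, of f 1] eq[OF ess_ball_bounded[of f \<mu> 1]] by auto
  qed (simp_all add: eq ess_bounded_add ess_bounded_cmult ess_operator_add[OF G] ess_operator_cmult[OF G])
  then show b: "T \<in> bounded_ops (Linf \<mu>)" using bounded_ops_iff by blast
  have im: "(\<lambda>f. T (ae_class \<mu> f)) ` ess_ball \<mu> 1 = G ` ess_ball \<mu> 1"
    by (rule image_cong) (auto simp: eq ess_ball_bounded)
  show "compact (closure (G ` ess_ball \<mu> 1)) \<Longrightarrow> T \<in> compact_ops (Linf \<mu>)"
    using b by (simp add: compact_ops_Linf im)
qed

lemma compact_closure_subset:
  fixes K :: "'a::t2_space set"
  assumes "compact K" "S \<subseteq> K"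
  shows "compact (closure S)"
proof -
  have "closure S \<subseteq> K" using assms by (intro closure_minimal compact_imp_closed)
  then have "closure S = K \<inter> closure S" by auto
  then show ?thesis using compact_Int_closed[OF assms(1), of "closure S"] by simp
qed

lemma compact_closure_image:
  fixes P :: "'a::metric_space \<Rightarrow> 'b::metric_space"
  assumes "continuous_on UNIV P" "compact (closure S)"
  shows "compact (closure (P ` S))"
proof (rule compact_closure_subset)
  show "compact (P ` closure S)"
    using assms by (intro compact_continuous_image) (auto intro: continuous_on_subset)
  show "P ` S \<subseteq> P ` closure S" using closure_subset by blast
qed

lemma norming_functional_bounded_linear:
  assumes "norming_functional \<phi> y0"
  shows "bounded_linear \<phi>"
proof (rule bounded_linear_intro[where K = 1])
  show "\<phi> (x + y) = \<phi> x + \<phi> y" for x y using assms by (simp add: norming_functional_def)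
  show "\<phi> (r *\<^sub>R x) = r *\<^sub>R \<phi> x" for r x
    using assms unfolding norming_functional_def by (metis scaleC_of_real scaleR_conv_of_real)
  show "norm (\<phi> x) \<le> norm x * 1" for x using assms by (simp add: norming_functional_def)
qed

section \<open>Consequences of complex uniform convexity\<close>

text \<open>
  The only place where the convexity of the target enters: \<open>G g + w G h\<close> is the image of
  \<open>g + w h\<close>, which lies in the unit ball for each unimodular \<open>w\<close>.
\<close>

lemma small_on_slack_of_near_norming:
  assumes Y: "C_uniformly_convex TYPE('y::complex_banach)" and e: "e > 0"
  obtains d where "d > 0"
    "\<And>(G :: ('a \<Rightarrow> complex) \<Rightarrow> 'y) g h. ess_operator \<mu> 1 G \<Longrightarrow> g \<in> ess_bounded \<mu> \<Longrightarrow> h \<in> ess_bounded \<mu> \<Longrightarrow>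
      AE t in \<mu>. cmod (g t) + cmod (h t) \<le> 1 \<Longrightarrow> norm (G g) \<ge> 1 - d \<Longrightarrow> norm (G h) \<le> e"
proof -
  obtain d where d: "d > 0" "\<And>y0 y1 :: 'y. (\<forall>w. cmod w = 1 \<longrightarrow> norm (y0 + w *\<^sub>C y1) \<le> 1) \<and> norm y1 > e \<Longrightarrow> norm y0 < 1 - d"
    using Y e unfolding C_uniformly_convex_def by blast
  have "norm (G h) \<le> e"
    if G: "ess_operator \<mu> 1 G" and g: "g \<in> ess_bounded \<mu>" and h: "h \<in> ess_bounded \<mu>"
      and ae: "AE t in \<mu>. cmod (g t) + cmod (h t) \<le> 1" and n: "norm (G g) \<ge> 1 - d" for G :: "('a \<Rightarrow> complex) \<Rightarrow> 'y" and g h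
  proof (rule ccontr)
    assume c: "\<not> norm (G h) \<le> e"
    have "norm (G g + w *\<^sub>C G h) \<le> 1" if w: "cmod w = 1" for w
    proof -
      have wh: "(\<lambda>t. w * h t) \<in> ess_bounded \<mu>" by (rule ess_bounded_cmult[OF h])
      have "AE t in \<mu>. cmod (g t + w * h t) \<le> 1"
        using ae by eventually_elim (rule norm_triangle_le, simp add: norm_mult w)
      then have "(\<lambda>t. g t + w * h t) \<in> ess_ball \<mu> 1"
        by (intro ess_ballI ess_bounded_measurable[OF ess_bounded_add[OF g wh]])
      from ess_operator_bound[OF G this] show ?thesis
        by (simp add: ess_operator_add[OF G g wh] ess_operator_cmult[OF G h])
    qed
    then have "norm (G g) < 1 - d" using c by (intro d(2)[of _ "G h"]) auto
    with n show False by simp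
  qed
  with d(1) show ?thesis by (rule that)
qed

text \<open>
  Uniform convexity of the disc, by the parallelogram law.
\<close>

lemma midpoint_disc_gap:
  fixes z :: complex
  assumes z: "cmod z \<le> 1" and b: "b > 0" "cmod (z - 1) > b"
  shows "cmod ((1 + z) / 2) \<le> 1 - b\<^sup>2 / 8"
proof -
  have "(cmod (1 + z))\<^sup>2 + (cmod (z - 1))\<^sup>2 = 2 + 2 * (cmod z)\<^sup>2"
    unfolding cmod_power2 by (simp add: power2_eq_square algebra_simps)
  moreover have "(cmod z)\<^sup>2 \<le> 1" using z by (simp add: power_le_one)
  moreover have "b\<^sup>2 < (cmod (z - 1))\<^sup>2" using b by (intro power_strict_mono) auto
  ultimately have *: "(cmod (1 + z))\<^sup>2 \<le> 4 - b\<^sup>2" by simp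
  then have b2: "b\<^sup>2 \<le> 4" using zero_le_power2[of "cmod (1 + z)"] by linarith
  have "(2 - b\<^sup>2 / 4)\<^sup>2 = 4 - b\<^sup>2 + (b\<^sup>2 / 4)\<^sup>2" by (simp add: power2_diff)
  then have "4 - b\<^sup>2 \<le> (2 - b\<^sup>2 / 4)\<^sup>2" by simp
  then have "(cmod (1 + z))\<^sup>2 \<le> (2 - b\<^sup>2 / 4)\<^sup>2" using * by linarith
  then have "cmod (1 + z) \<le> 2 - b\<^sup>2 / 4" by (rule power2_le_imp_le) (use b2 in simp)
  then show ?thesis by (simp add: norm_divide)
qed

text \<open>
  The function \<open>(f - 1) h\<close> is cut at \<open>cmod (f - 1) = b\<close>. The part below is small in norm. The
  part above lives where \<open>(1 + f) / 2\<close> has modulus at most \<open>1 - b\<^sup>2 / 8\<close>, so a fixed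
  multiple of it fits into the slack left by \<open>(1 + f) / 2\<close> and has a small image.
\<close>

lemma multiplier_near_identity:
  assumes Y: "C_uniformly_convex TYPE('y::complex_banach)" and e: "e > 0"
  obtains d where "d > 0"
    "\<And>(G :: ('a \<Rightarrow> complex) \<Rightarrow> 'y) f h. ess_operator \<mu> 1 G \<Longrightarrow> f \<in> ess_ball \<mu> 1 \<Longrightarrow> h \<in> ess_ball \<mu> 1 \<Longrightarrow>
      norm (G (\<lambda>t. (1 + f t) / 2)) \<ge> 1 - d \<Longrightarrow> norm (G (\<lambda>t. (f t - 1) * h t)) \<le> e"
proof -
  define b where "b = e / 2"
  \<comment> \<open>The part above the cut has modulus at most \<open>2\<close>; scaled by \<open>b\<^sup>2 / 16\<close> it fits into the gap
    \<open>b\<^sup>2 / 8\<close>, and undoing the scaling turns \<open>e'\<close> into \<open>b\<close>.\<close>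
  define e' where "e' = b * b\<^sup>2 / 16"
  have b: "b > 0" and e': "e' > 0" using e by (simp_all add: b_def e'_def)
  obtain d where d: "d > 0"
    "\<And>(G :: ('a \<Rightarrow> complex) \<Rightarrow> 'y) g h. ess_operator \<mu> 1 G \<Longrightarrow> g \<in> ess_bounded \<mu> \<Longrightarrow> h \<in> ess_bounded \<mu> \<Longrightarrow>
      AE t in \<mu>. cmod (g t) + cmod (h t) \<le> 1 \<Longrightarrow> norm (G g) \<ge> 1 - d \<Longrightarrow> norm (G h) \<le> e'"
    using small_on_slack_of_near_norming[OF Y e'] by blast
  have "norm (G (\<lambda>t. (f t - 1) * h t)) \<le> e"
    if G: "ess_operator \<mu> 1 G" and f: "f \<in> ess_ball \<mu> 1" and h: "h \<in> ess_ball \<mu> 1"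
      and n: "norm (G (\<lambda>t. (1 + f t) / 2)) \<ge> 1 - d" for G :: "('a \<Rightarrow> complex) \<Rightarrow> 'y" and f h
  proof -
    note [measurable] = ess_ball_measurable[OF f] ess_ball_measurable[OF h]
    define u1 where "u1 t = (if cmod (f t - 1) \<le> b then (f t - 1) * h t else 0)" for t
    define u2 where "u2 t = (if cmod (f t - 1) \<le> b then 0 else (f t - 1) * h t)" for t
    have [measurable]: "u1 \<in> borel_measurable \<mu>" unfolding u1_def by measurable
    have [measurable]: "u2 \<in> borel_measurable \<mu>" unfolding u2_def by measurable
    have fh: "cmod ((f t - 1) * h t) \<le> 2" if "cmod (f t) \<le> 1" "cmod (h t) \<le> 1" for t
    proof -
      have "cmod (f t - 1) \<le> 2" using that norm_triangle_ineq4[of "f t" 1] by simp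
      then have "cmod (f t - 1) * cmod (h t) \<le> 2 * 1" using that by (intro mult_mono) auto
      then show ?thesis by (simp add: norm_mult)
    qed
    have u1: "u1 \<in> ess_ball \<mu> b"
    proof (rule ess_ballI)
      show "AE t in \<mu>. cmod (u1 t) \<le> b"
        using ess_ball_AE[OF h]
      proof eventually_elim
        case (elim t)
        have "cmod (f t - 1) * cmod (h t) \<le> b * 1" if "cmod (f t - 1) \<le> b"
          using that elim b by (intro mult_mono) auto
        then show ?case using b by (simp add: u1_def norm_mult)
      qed
    qed simp
    have u2: "u2 \<in> ess_ball \<mu> 2"
    proof (rule ess_ballI)
      show "AE t in \<mu>. cmod (u2 t) \<le> 2"
        using ess_ball_AE[OF f] ess_ball_AE[OF h] by eventually_elim (simp add: u2_def fh)
    qed simp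
    define s where "s = complex_of_real (b\<^sup>2 / 16)"
    have "norm (G (\<lambda>t. s * u2 t)) \<le> e'"
    proof (rule d(2)[OF G _ _ _ n])
      show "(\<lambda>t. (1 + f t) / 2) \<in> ess_bounded \<mu>"
        using ess_bounded_cmult[OF ess_bounded_add[OF ess_bounded_const[of 1] ess_ball_bounded[OF f]], of "1/2"] by simp
      show "(\<lambda>t. s * u2 t) \<in> ess_bounded \<mu>" by (rule ess_bounded_cmult[OF ess_ball_bounded[OF u2]])
      show "AE t in \<mu>. cmod ((1 + f t) / 2) + cmod (s * u2 t) \<le> 1"
        using ess_ball_AE[OF f] ess_ball_AE[OF h]
      proof eventually_elim
        case (elim t)
        show ?case
        proof (cases "cmod (f t - 1) \<le> b")
          case True
          then show ?thesis using elim norm_triangle_ineq[of 1 "f t"] by (simp add: u2_def norm_divide)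
        next
          case False
          have "cmod (s * u2 t) = b\<^sup>2 / 16 * cmod ((f t - 1) * h t)"
            using False by (simp add: u2_def s_def norm_mult norm_divide norm_power)
          also have "\<dots> \<le> b\<^sup>2 / 16 * 2" by (intro mult_left_mono fh elim) simp
          finally show ?thesis using midpoint_disc_gap[OF elim(1) b] False by simp
        qed
      qed
    qed
    moreover have "cmod s = b\<^sup>2 / 16" by (simp add: s_def norm_divide norm_power)
    ultimately have "b\<^sup>2 / 16 * norm (G u2) \<le> b\<^sup>2 / 16 * b"
      unfolding ess_operator_cmult[OF G ess_ball_bounded[OF u2]] norm_scaleC by (simp add: e'_def mult.commute)
    then have "norm (G u2) \<le> b" using b by (subst (asm) mult_le_cancel_left_pos) auto
    moreover have "norm (G u1) \<le> b" using ess_operator_bound[OF G u1] b by simp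
    moreover have "(\<lambda>t. (f t - 1) * h t) = (\<lambda>t. u1 t + u2 t)" by (auto simp: u1_def u2_def)
    ultimately have "norm (G (\<lambda>t. (f t - 1) * h t)) \<le> b + b"
      using norm_triangle_mono[of "G u1" b "G u2" b]
      by (simp add: ess_operator_add[OF G ess_ball_bounded[OF u1] ess_ball_bounded[OF u2]])
    then show ?thesis by (simp add: b_def)
  qed
  with d(1) show ?thesis by (rule that)
qed

section \<open>Perturbation by rank one operators\<close>

definition rank_one_shift :: "('y::complex_banach \<Rightarrow> complex) \<Rightarrow> real \<Rightarrow> 'y \<Rightarrow> 'y \<Rightarrow> 'y" where
  "rank_one_shift \<phi> d v y = y + (complex_of_real d * \<phi> y) *\<^sub>C v"

lemma rank_one_shift_properties:
  assumes \<phi>: "norming_functional \<phi> y0" and d: "d \<ge> 0" and v: "norm v \<le> 1"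
  shows "rank_one_shift \<phi> d v (x + y) = rank_one_shift \<phi> d v x + rank_one_shift \<phi> d v y"
    and "rank_one_shift \<phi> d v (a *\<^sub>C x) = a *\<^sub>C rank_one_shift \<phi> d v x"
    and "norm (rank_one_shift \<phi> d v x) \<le> norm x + d * cmod (\<phi> x)"
    and "norm (rank_one_shift \<phi> d v x) \<le> (1 + d) * norm x"
    and "norm (rank_one_shift \<phi> d v x - x) \<le> d * norm x"
    and "continuous_on UNIV (rank_one_shift \<phi> d v)"
proof -
  have \<phi>1: "\<phi> (x + y) = \<phi> x + \<phi> y" "\<phi> (a *\<^sub>C x) = a * \<phi> x" "cmod (\<phi> x) \<le> norm x" for x y a
    using \<phi> by (auto simp: norming_functional_def)
  show "rank_one_shift \<phi> d v (x + y) = rank_one_shift \<phi> d v x + rank_one_shift \<phi> d v y"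
    by (simp add: rank_one_shift_def \<phi>1 distrib_left scaleC_add_left)
  show "rank_one_shift \<phi> d v (a *\<^sub>C x) = a *\<^sub>C rank_one_shift \<phi> d v x"
    by (simp add: rank_one_shift_def \<phi>1 scaleC_add_right scaleC_scaleC mult.left_commute)
  have *: "norm ((complex_of_real d * \<phi> x) *\<^sub>C v) \<le> d * cmod (\<phi> x)"
    using d v mult_mono[of "d * cmod (\<phi> x)" "d * cmod (\<phi> x)" "norm v" 1] by (simp add: norm_scaleC norm_mult)
  show 1: "norm (rank_one_shift \<phi> d v x) \<le> norm x + d * cmod (\<phi> x)"
    unfolding rank_one_shift_def by (rule norm_triangle_le) (use * in simp)
  have 2: "d * cmod (\<phi> x) \<le> d * norm x" using \<phi>1(3) d by (rule mult_left_mono)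
  show "norm (rank_one_shift \<phi> d v x) \<le> (1 + d) * norm x"
    using 1 2 by (simp add: algebra_simps)
  show "norm (rank_one_shift \<phi> d v x - x) \<le> d * norm x"
    using * 2 by (simp add: rank_one_shift_def)
  show "continuous_on UNIV (rank_one_shift \<phi> d v)"
    unfolding rank_one_shift_def
    by (intro continuous_intros bounded_linear.continuous_on[OF norming_functional_bounded_linear[OF \<phi>]])
qed

text \<open>
  The witness condition of \<open>RSE\<close> for an operator of norm one, on the level of functions.
\<close>

definition range_exposing :: "'a measure \<Rightarrow> (('a \<Rightarrow> complex) \<Rightarrow> 'y::complex_banach) \<Rightarrow> ('a \<Rightarrow> complex) \<Rightarrow> bool" where
  "range_exposing \<mu> H u \<longleftrightarrow>
     (\<forall>x. (\<forall>n. x n \<in> ess_ball \<mu> 1) \<and> (\<lambda>n. norm (H (x n))) \<longlonglongrightarrow> 1 \<longrightarrow>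
       (\<exists>\<sigma> c. strict_mono (\<sigma> :: nat \<Rightarrow> nat) \<and> cmod c = 1 \<and> (\<lambda>n. H (x (\<sigma> n))) \<longlonglongrightarrow> c *\<^sub>C H u))"

text \<open>
  With \<open>v = G 1\<close> and \<open>\<phi>\<close> norming \<open>v\<close>, take \<open>H = (G + d \<phi>(G) v) / (1 + d)\<close>. A
  sequence that norms \<open>H\<close> satisfies \<open>cmod (\<phi> (G x\<^sub>n)) \<rightarrow> 1\<close>; after rotation, \<open>1\<close> and
  \<open>x\<^sub>n\<close> norm \<open>G\<close> in a common direction, so \<open>G (x\<^sub>n - 1) \<rightarrow> 0\<close>.
\<close>

lemma perturb_to_exposing_at_one:
  fixes G :: "('a \<Rightarrow> complex) \<Rightarrow> 'y::complex_banach"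
  assumes Y: "C_uniformly_convex TYPE('y)" and e: "e > 0"
    and G: "ess_operator \<mu> 1 G" and cp: "compact (closure (G ` ess_ball \<mu> 1))" and G1: "norm (G (\<lambda>_. 1)) = 1"
  obtains H where "ess_operator \<mu> 1 H" "compact (closure (H ` ess_ball \<mu> 1))" "norm (H (\<lambda>_. 1)) = 1"
    "\<And>f. f \<in> ess_ball \<mu> 1 \<Longrightarrow> norm (H f - G f) \<le> e"
    "\<And>f. G f = 0 \<Longrightarrow> H f = 0"
    "range_exposing \<mu> H (\<lambda>_. 1)"
proof -
  define v where "v = G (\<lambda>_. 1)"
  have v: "norm v = 1" using G1 by (simp add: v_def)
  obtain \<phi> where \<phi>: "norming_functional \<phi> v" by (rule norming_functional_exists)
  have \<phi>1: "\<phi> (x + y) = \<phi> x + \<phi> y" "\<phi> (a *\<^sub>C x) = a * \<phi> x" "cmod (\<phi> x) \<le> norm x" "\<phi> v = 1" for x y a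
    using \<phi> v by (auto simp: norming_functional_def)
  define d where "d = e / 2"
  have d: "d > 0" using e by (simp add: d_def)
  define P where "P y = complex_of_real (1 / (1 + d)) *\<^sub>C rank_one_shift \<phi> d v y" for y
  note r = rank_one_shift_properties[OF \<phi>, of d v]
  have Padd: "P (x + y) = P x + P y" and Psc: "P (a *\<^sub>C x) = a *\<^sub>C P x" for x y a
    using r d v by (auto simp: P_def scaleC_add_right scaleC_scaleC mult.commute)
  have nP: "norm (P y) = norm (rank_one_shift \<phi> d v y) / (1 + d)" for y
    using d by (simp add: P_def norm_scaleC norm_divide del: of_real_divide of_real_add)
  have P1: "(1 + d) * norm (P y) \<le> norm y + d * cmod (\<phi> y)" for y
    using r(3)[of y] d v nP[of y] by simp
  have Pb: "norm (P y) \<le> norm y" for y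
  proof -
    have "(1 + d) * norm (P y) \<le> (1 + d) * norm y" using r(4)[of y] d v nP[of y] by simp
    then show ?thesis using d by simp
  qed
  have Pd: "norm (P y - y) \<le> e * norm y" for y
  proof -
    have "norm (P y - rank_one_shift \<phi> d v y) = d * norm (P y)"
    proof -
      have "rank_one_shift \<phi> d v y = complex_of_real (1 + d) *\<^sub>C P y"
        using d unfolding P_def scaleC_scaleC of_real_mult[symmetric] by simp
      then have "P y - rank_one_shift \<phi> d v y = complex_of_real (- d) *\<^sub>C P y"
        by (simp add: scaleC_add_left scaleC_minus_left)
      then show ?thesis using d by (simp add: norm_scaleC del: of_real_minus)
    qed
    moreover have "d * norm (P y) \<le> d * norm y" using Pb d by simp
    moreover have "norm (rank_one_shift \<phi> d v y - y) \<le> d * norm y" using r(5) d v by simp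
    ultimately have "norm ((P y - rank_one_shift \<phi> d v y) + (rank_one_shift \<phi> d v y - y)) \<le> d * norm y + d * norm y"
      by (intro norm_triangle_mono) auto
    then show ?thesis by (simp add: d_def)
  qed
  have Pc: "continuous_on UNIV P" unfolding P_def using r(6) d v by (intro continuous_intros) auto
  have P0: "P 0 = 0" using Pb[of 0] by simp
  have Pv: "P v = v"
  proof -
    have "rank_one_shift \<phi> d v v = complex_of_real (1 + d) *\<^sub>C v"
      by (simp add: rank_one_shift_def \<phi>1(4) scaleC_add_left)
    then show ?thesis using d unfolding P_def by (simp add: scaleC_scaleC del: of_real_divide of_real_add add: of_real_mult[symmetric])
  qed
  define H where "H f = P (G f)" for f
  have one: "(\<lambda>_. 1) \<in> ess_ball \<mu> 1" by (rule ess_ball_const) simp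
  have Gb: "norm (G f) \<le> 1" if "f \<in> ess_ball \<mu> 1" for f using ess_operator_bound[OF G that] by simp
  show ?thesis
  proof (rule that[of H])
    show "ess_operator \<mu> 1 H"
    proof (rule ess_operatorI)
      show "norm (H f) \<le> 1" if "f \<in> ess_ball \<mu> 1" for f
        using Pb[of "G f"] Gb[OF that] by (simp add: H_def)
    qed (simp_all add: H_def ess_operator_add[OF G] ess_operator_cmult[OF G] Padd Psc)
    have "H ` ess_ball \<mu> 1 = P ` (G ` ess_ball \<mu> 1)" by (auto simp: H_def)
    then show "compact (closure (H ` ess_ball \<mu> 1))" using compact_closure_image[OF Pc cp] by simp
    show "norm (H (\<lambda>_. 1)) = 1" using Pv v by (simp add: H_def v_def)
    show "norm (H f - G f) \<le> e" if "f \<in> ess_ball \<mu> 1" for f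
    proof -
      have "e * norm (G f) \<le> e * 1" using Gb[OF that] e by (intro mult_left_mono) auto
      then show ?thesis using Pd[of "G f"] by (simp add: H_def)
    qed
    show "H f = 0" if "G f = 0" for f using that P0 by (simp add: H_def)
    show "range_exposing \<mu> H (\<lambda>_. 1)"
      unfolding range_exposing_def
    proof (intro allI impI)
      fix x assume "(\<forall>n. x n \<in> ess_ball \<mu> 1) \<and> (\<lambda>n. norm (H (x n))) \<longlonglongrightarrow> 1"
      then have x: "\<And>n. x n \<in> ess_ball \<mu> 1" and lim: "(\<lambda>n. norm (H (x n))) \<longlonglongrightarrow> 1" by auto
      define c where "c n = \<phi> (G (x n))" for n
      have c1: "cmod (c n) \<le> 1" for n using \<phi>1(3)[of "G (x n)"] Gb[OF x] by (simp add: c_def order_trans)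
      \<comment> \<open>The shift contributes at most \<open>d * cmod (c n)\<close> and \<open>G\<close> at most \<open>1\<close>, so a norm close to \<open>1 + d\<close>
        before scaling needs \<open>cmod (c n)\<close> close to \<open>1\<close>.\<close>
      have c2: "((1 + d) * norm (H (x n)) - 1) / d \<le> cmod (c n)" for n
        using P1[of "G (x n)"] Gb[OF x, of n] d by (simp add: c_def H_def field_simps)
      have "(\<lambda>n. ((1 + d) * norm (H (x n)) - 1) / d) \<longlonglongrightarrow> ((1 + d) * 1 - 1) / d"
        using d by (intro tendsto_intros lim) auto
      then have "(\<lambda>n. ((1 + d) * norm (H (x n)) - 1) / d) \<longlonglongrightarrow> 1" using d by simp
      then have cl: "(\<lambda>n. cmod (c n)) \<longlonglongrightarrow> 1"
        by (rule tendsto_sandwich[OF always_eventually[OF allI[OF c2]] always_eventually[OF allI[OF c1]] _ tendsto_const])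
      have "\<forall>n. c n \<in> cball 0 1" using c1 by simp
      then obtain a \<sigma> where a: "strict_mono \<sigma>" "(c \<circ> \<sigma>) \<longlonglongrightarrow> a"
        using compact_cball[of "0::complex" 1] unfolding compact_def by metis
      have "(\<lambda>n. cmod (c (\<sigma> n))) \<longlonglongrightarrow> 1" using LIMSEQ_subseq_LIMSEQ[OF cl a(1)] by (simp add: o_def)
      moreover have "(\<lambda>n. cmod (c (\<sigma> n))) \<longlonglongrightarrow> cmod a" using tendsto_norm[OF a(2)] by (simp add: o_def)
      ultimately have a1: "cmod a = 1" using LIMSEQ_unique by blast
      have aa: "cnj a * a = 1" "a * cnj a = 1"
        using a1 by (simp_all add: complex_norm_square[symmetric] mult.commute[of "cnj a"])
      define f where "f n = (\<lambda>t. cnj a * x (\<sigma> n) t)" for n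
      have f: "f n \<in> ess_ball \<mu> 1" for n
        using ess_ball_cmult[OF x, of "cnj a"] a1 by (simp add: f_def)
      have Gf: "G (f n) = cnj a *\<^sub>C G (x (\<sigma> n))" for n
        unfolding f_def by (rule ess_operator_cmult[OF G ess_ball_bounded[OF x]])
      have "(\<lambda>n. cnj a * (c \<circ> \<sigma>) n) \<longlonglongrightarrow> cnj a * a" by (intro tendsto_intros a)
      then have "(\<lambda>n. Re (\<phi> (G (f n)))) \<longlonglongrightarrow> 1"
        unfolding Gf \<phi>1(2) aa using tendsto_Re by (fastforce simp: c_def)
      have "(\<lambda>n. G (f n) - v) \<longlonglongrightarrow> 0"
      proof (rule LIMSEQ_I)
        fix q :: real assume "q > 0"
        then have "q / 2 > 0" by simp
        then obtain d' where d': "d' > 0"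
          "\<And>(G :: ('a \<Rightarrow> complex) \<Rightarrow> 'y) f h. ess_operator \<mu> 1 G \<Longrightarrow> f \<in> ess_ball \<mu> 1 \<Longrightarrow> h \<in> ess_ball \<mu> 1 \<Longrightarrow>
            norm (G (\<lambda>t. (1 + f t) / 2)) \<ge> 1 - d' \<Longrightarrow> norm (G (\<lambda>t. (f t - 1) * h t)) \<le> q / 2"
          using multiplier_near_identity[OF Y] by blast
        have "eventually (\<lambda>n. Re (\<phi> (G (f n))) > 1 - d') sequentially"
          using \<open>(\<lambda>n. Re (\<phi> (G (f n)))) \<longlonglongrightarrow> 1\<close> d'(1) by (intro order_tendstoD(1)) auto
        then obtain N where N: "\<And>n. n \<ge> N \<Longrightarrow> Re (\<phi> (G (f n))) > 1 - d'" by (auto simp: eventually_sequentially)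
        have "norm (G (f n) - v - 0) < q" if "n \<ge> N" for n
        proof -
          have "G (\<lambda>t. (1/2) * (1 + f n t)) = (1/2) *\<^sub>C (v + G (f n))"
            unfolding v_def
            by (simp only: ess_operator_cmult[OF G ess_bounded_add[OF ess_bounded_const ess_ball_bounded[OF f]]]
                ess_operator_add[OF G ess_bounded_const ess_ball_bounded[OF f]])
          then have eq: "G (\<lambda>t. (1 + f n t) / 2) = (1/2) *\<^sub>C (v + G (f n))" by simp
          have "1 - d' \<le> Re (\<phi> (G (\<lambda>t. (1 + f n t) / 2)))"
            unfolding eq \<phi>1(1,2,4) using N[OF that] d'(1) by simp
          also have "\<dots> \<le> norm (G (\<lambda>t. (1 + f n t) / 2))"
            using complex_Re_le_cmod \<phi>1(3) order_trans by blast
          finally have "norm (G (\<lambda>t. (f n t - 1) * 1)) \<le> q / 2" by (intro d'(2)[OF G f one])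
          then show ?thesis
            using \<open>q > 0\<close> ess_operator_diff[OF G ess_ball_bounded[OF f] ess_bounded_const[of 1], of n] by (simp add: v_def)
        qed
        then show "\<exists>N. \<forall>n\<ge>N. norm (G (f n) - v - 0) < q" by blast
      qed
      then have "(\<lambda>n. a *\<^sub>C G (f n)) \<longlonglongrightarrow> a *\<^sub>C v"
        by (intro tendsto_intros) (simp add: LIM_zero_iff)
      then have "(\<lambda>n. G (x (\<sigma> n))) \<longlonglongrightarrow> a *\<^sub>C v" by (simp add: Gf scaleC_scaleC aa)
      then have "(\<lambda>n. P (G (x (\<sigma> n)))) \<longlonglongrightarrow> P (a *\<^sub>C v)"
        using Pc by (intro continuous_on_tendsto_compose[OF Pc]) auto
      then have "(\<lambda>n. H (x (\<sigma> n))) \<longlonglongrightarrow> a *\<^sub>C H (\<lambda>_. 1)" by (simp add: H_def Psc v_def)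
      with a(1) a1 show "\<exists>\<sigma> c. strict_mono (\<sigma> :: nat \<Rightarrow> nat) \<and> cmod c = 1 \<and> (\<lambda>n. H (x (\<sigma> n))) \<longlonglongrightarrow> c *\<^sub>C H (\<lambda>_. 1)"
        by blast
    qed
  qed
qed

text \<open>
  The near-maximizers are transported to the constant \<open>1\<close>: the operator \<open>f \<mapsto> T (z\<^sub>n f)\<close> almost
  attains its norm at \<open>1\<close>, and a limit of these operators attains it. The last clause, that \<open>H\<close>
  annihilates \<open>h\<close> as soon as \<open>G\<close> annihilates all multiples of \<open>h\<close>, keeps track of supports.
\<close>

lemma perturb_to_attain_at_one:
  assumes Y: "C_uniformly_convex TYPE('y::complex_banach)" and e: "e > 0"
  obtains \<eta> where "\<eta> > 0"
    "\<And>G :: ('a \<Rightarrow> complex) \<Rightarrow> 'y. ess_operator \<mu> 1 G \<Longrightarrow> compact (closure (G ` ess_ball \<mu> 1)) \<Longrightarrow>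
      norm (G (\<lambda>_. 1)) > 1 - \<eta> \<Longrightarrow>
      \<exists>H. ess_operator \<mu> 1 H \<and> compact (closure (H ` ess_ball \<mu> 1)) \<and> norm (H (\<lambda>_. 1)) = 1 \<and>
        (\<forall>f\<in>ess_ball \<mu> 1. norm (H f - G f) \<le> e) \<and>
        (\<forall>h\<in>ess_bounded \<mu>. (\<forall>g\<in>ess_bounded \<mu>. G (\<lambda>t. g t * h t) = 0) \<longrightarrow> H h = 0)"
proof -
  define d where "d = min 1 (e / 4)"
  have d: "d > 0" "d \<le> 1" "d \<le> e / 4" using e by (auto simp: d_def)
  have e4: "e / 4 > 0" using e by simp
  obtain k where k: "k > 0"
    "\<And>(G :: ('a \<Rightarrow> complex) \<Rightarrow> 'y) f h. ess_operator \<mu> 1 G \<Longrightarrow> f \<in> ess_ball \<mu> 1 \<Longrightarrow> h \<in> ess_ball \<mu> 1 \<Longrightarrow>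
      norm (G (\<lambda>t. (1 + f t) / 2)) \<ge> 1 - k \<Longrightarrow> norm (G (\<lambda>t. (f t - 1) * h t)) \<le> e / 4"
    using multiplier_near_identity[OF Y e4] by blast
  \<comment> \<open>The first bound keeps the norm of the perturbed operator in \<open>[1, 1 + d]\<close>; the second makes its
    near-maximizers \<open>z\<close> satisfy \<open>\<phi> (G z) \<ge> 1 - k\<close>.\<close>
  define \<eta> where "\<eta> = min (d / 3) (d * k / 4)"
  have \<eta>: "\<eta> > 0" "\<eta> \<le> d / 3" "4 * \<eta> \<le> d * k" using d k(1) by (auto simp: \<eta>_def)
  have "\<exists>H. ess_operator \<mu> 1 H \<and> compact (closure (H ` ess_ball \<mu> 1)) \<and> norm (H (\<lambda>_. 1)) = 1 \<and>
        (\<forall>f\<in>ess_ball \<mu> 1. norm (H f - G f) \<le> e) \<and>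
        (\<forall>h\<in>ess_bounded \<mu>. (\<forall>g\<in>ess_bounded \<mu>. G (\<lambda>t. g t * h t) = 0) \<longrightarrow> H h = 0)"
    if G: "ess_operator \<mu> 1 G" and cp: "compact (closure (G ` ess_ball \<mu> 1))"
      and G1: "norm (G (\<lambda>_. 1)) > 1 - \<eta>" for G :: "('a \<Rightarrow> complex) \<Rightarrow> 'y"
  proof -
    define v where "v = G (\<lambda>_. 1)"
    define \<rho> where "\<rho> = norm v"
    have one: "(\<lambda>_. 1) \<in> ess_ball \<mu> 1" by (rule ess_ball_const) simp
    have Gb: "norm (G f) \<le> 1" if "f \<in> ess_ball \<mu> 1" for f using ess_operator_bound[OF G that] by simp
    have \<rho>: "\<rho> > 1 - \<eta>" "\<rho> \<le> 1" using G1 Gb[OF one] by (auto simp: \<rho>_def v_def)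
    obtain \<phi> where \<phi>: "norming_functional \<phi> v" by (rule norming_functional_exists)
    have \<phi>1: "\<phi> (x + y) = \<phi> x + \<phi> y" "\<phi> (a *\<^sub>C x) = a * \<phi> x" "cmod (\<phi> x) \<le> norm x" "\<phi> v = \<rho>" for x y a
      using \<phi> by (auto simp: norming_functional_def \<rho>_def)
    define P where "P = rank_one_shift \<phi> d v"
    have nv: "norm v \<le> 1" using \<rho>(2) by (simp add: \<rho>_def)
    note P = rank_one_shift_properties[OF \<phi> less_imp_le[OF d(1)] nv, folded P_def]
    define T where "T f = P (G f)" for f
    have Tb: "norm (T f) \<le> 1 + d" if "f \<in> ess_ball \<mu> 1" for f
    proof -
      have "(1 + d) * norm (G f) \<le> (1 + d) * 1" using Gb[OF that] d by (intro mult_left_mono) auto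
      then show ?thesis using P(4)[of "G f"] by (simp add: T_def)
    qed
    have T: "ess_operator \<mu> (1 + d) T"
      by (rule ess_operatorI) (simp_all add: Tb, simp_all add: T_def ess_operator_add[OF G] ess_operator_cmult[OF G] P)
    have "T ` ess_ball \<mu> 1 = P ` (G ` ess_ball \<mu> 1)" by (auto simp: T_def)
    then have Tc: "compact (closure (T ` ess_ball \<mu> 1))" using compact_closure_image[OF P(6) cp] by simp
    define N where "N = (SUP f\<in>ess_ball \<mu> 1. norm (T f))"
    have bdd: "bdd_above ((\<lambda>f. norm (T f)) ` ess_ball \<mu> 1)" by (rule bdd_aboveI2[OF Tb])
    have TN: "norm (T f) \<le> N" if "f \<in> ess_ball \<mu> 1" for f unfolding N_def by (rule cSUP_upper[OF that bdd])
    have "N \<le> 1 + d" unfolding N_def using one Tb by (intro cSUP_least) auto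
    have T1: "norm (T (\<lambda>_. 1)) \<ge> 1 + d - 3 * \<eta>"
    proof -
      have "T (\<lambda>_. 1) = complex_of_real (1 + d * \<rho>) *\<^sub>C v"
        unfolding T_def v_def[symmetric] P_def rank_one_shift_def \<phi>1(4) by (simp add: scaleC_add_left)
      then have nT: "norm (T (\<lambda>_. 1)) = (1 + d * \<rho>) * \<rho>"
        using d \<rho> \<eta> by (simp add: norm_scaleC \<rho>_def del: of_real_add of_real_mult)
      have "(1 - \<eta>) * (1 - \<eta>) \<le> \<rho> * \<rho>" using \<rho> \<eta> d by (intro mult_mono) auto
      moreover have "1 - 2 * \<eta> + \<eta> * \<eta> = (1 - \<eta>) * (1 - \<eta>)" by (simp add: algebra_simps)
      ultimately have "1 - 2 * \<eta> \<le> \<rho> * \<rho>" using zero_le_square[of \<eta>] by linarith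
      then have "d * (1 - 2 * \<eta>) \<le> d * (\<rho> * \<rho>)" using d by (intro mult_left_mono) auto
      then have "d - 2 * (d * \<eta>) \<le> d * (\<rho> * \<rho>)" by (simp add: algebra_simps)
      moreover have "d * \<eta> \<le> 1 * \<eta>" using d \<eta> by (intro mult_right_mono) auto
      moreover have "norm (T (\<lambda>_. 1)) = \<rho> + d * (\<rho> * \<rho>)" using nT by (simp add: algebra_simps)
      ultimately show ?thesis using \<rho>(1) by linarith
    qed
    have N: "1 \<le> N" "N \<le> 1 + d" "N \<ge> 1 + d - 3 * \<eta>"
      using T1 TN[OF one] \<open>N \<le> 1 + d\<close> \<eta> by auto
    have "\<exists>z\<in>ess_ball \<mu> 1. norm (T z) > N - min \<eta> (1 / real (Suc n)) \<and> \<phi> (G z) = complex_of_real (cmod (\<phi> (G z)))" for n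
    proof -
      have "\<exists>z\<in>ess_ball \<mu> 1. N - min \<eta> (1 / real (Suc n)) < norm (T z)"
        using less_cSUP_iff[OF _ bdd, of "N - min \<eta> (1 / real (Suc n))"] one \<eta>(1) unfolding N_def by force
      then obtain z where z: "z \<in> ess_ball \<mu> 1" "N - min \<eta> (1 / real (Suc n)) < norm (T z)" by auto
      obtain c where c: "cmod c = 1" "c * \<phi> (G z) = complex_of_real (cmod (\<phi> (G z)))" by (rule unimodular_rotation)
      show ?thesis
      proof (intro bexI conjI)
        show "(\<lambda>t. c * z t) \<in> ess_ball \<mu> 1" using ess_ball_cmult[OF z(1), of c] c by simp
        show "N - min \<eta> (1 / real (Suc n)) < norm (T (\<lambda>t. c * z t))"
          using z(2) c by (simp add: ess_operator_cmult[OF T ess_ball_bounded[OF z(1)]] norm_scaleC)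
        show "\<phi> (G (\<lambda>t. c * z t)) = complex_of_real (cmod (\<phi> (G (\<lambda>t. c * z t))))"
          using c by (simp add: ess_operator_cmult[OF G ess_ball_bounded[OF z(1)]] \<phi>1(2) norm_mult)
      qed
    qed
    then obtain z where z: "\<And>n. z n \<in> ess_ball \<mu> 1"
      "\<And>n. norm (T (z n)) > N - min \<eta> (1 / real (Suc n))"
      "\<And>n. \<phi> (G (z n)) = complex_of_real (cmod (\<phi> (G (z n))))" by metis
    \<comment> \<open>The constant \<open>1\<close> and every \<open>z n\<close> norm \<open>G\<close> up to a small error in the direction of \<open>\<phi>\<close>, hence
      so does their midpoint.\<close>
    have near: "norm (T (\<lambda>t. z n t * f t) - T f) \<le> e / 2" if f: "f \<in> ess_ball \<mu> 1" for n f
    proof -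
      have zb: "z n \<in> ess_bounded \<mu>" and fb: "f \<in> ess_bounded \<mu>" by (rule ess_ball_bounded, fact)+
      have "1 + d - 4 * \<eta> \<le> norm (T (z n))" using z(2)[of n] N(3) by linarith
      also have "\<dots> \<le> 1 + d * cmod (\<phi> (G (z n)))" using P(3)[of "G (z n)"] Gb[OF z(1), of n] by (simp add: T_def)
      finally have "d * (1 - k) \<le> d * cmod (\<phi> (G (z n)))" using \<eta>(3) by (simp add: algebra_simps)
      then have "1 - k \<le> cmod (\<phi> (G (z n)))" using d(1) by simp
      then have re: "1 - k \<le> Re (\<phi> (G (z n)))" by (subst z(3)) simp
      have "\<eta> \<le> k"
      proof -
        have "d * k \<le> 1 * k" using d k by (intro mult_right_mono) auto
        then show ?thesis using \<eta> by linarith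
      qed
      have "G (\<lambda>t. (1/2) * (1 + z n t)) = (1/2) *\<^sub>C (v + G (z n))"
        unfolding v_def
        by (simp only: ess_operator_cmult[OF G ess_bounded_add[OF ess_bounded_const zb]]
            ess_operator_add[OF G ess_bounded_const zb])
      then have eq: "G (\<lambda>t. (1 + z n t) / 2) = (1/2) *\<^sub>C (v + G (z n))" by simp
      have "1 - k \<le> Re (\<phi> (G (\<lambda>t. (1 + z n t) / 2)))"
        unfolding eq \<phi>1(1,2,4) using re \<rho>(1) \<open>\<eta> \<le> k\<close> by simp
      also have "\<dots> \<le> norm (G (\<lambda>t. (1 + z n t) / 2))"
        using complex_Re_le_cmod \<phi>1(3) order_trans by blast
      finally have small: "norm (G (\<lambda>t. (z n t - 1) * f t)) \<le> e / 4" by (intro k(2)[OF G z(1) f])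
      have "T (\<lambda>t. z n t * f t) - T f = T (\<lambda>t. (z n t - 1) * f t)"
        using ess_operator_diff[OF T ess_bounded_mult[OF zb fb] fb] by (simp add: algebra_simps)
      also have "norm \<dots> \<le> (1 + d) * norm (G (\<lambda>t. (z n t - 1) * f t))"
        unfolding T_def by (rule P(4))
      also have "\<dots> \<le> 2 * (e / 4)" using small d by (intro mult_mono) auto
      finally show ?thesis by simp
    qed
    have zT: "norm (T (z n)) \<le> N" for n by (rule TN[OF z(1)])
    have zlim: "(\<lambda>n. norm (T (z n))) \<longlonglongrightarrow> N"
    proof (rule tendsto_sandwich[OF _ _ _ tendsto_const])
      show "(\<lambda>n. N - 1 / real (Suc n)) \<longlonglongrightarrow> N"
        using tendsto_diff[OF tendsto_const LIMSEQ_Suc[OF lim_1_over_n], of N] by simp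
      show "\<forall>\<^sub>F n in sequentially. N - 1 / real (Suc n) \<le> norm (T (z n))"
        using z(2) by (intro always_eventually allI) (meson diff_left_mono less_imp_le min.cobounded2 order_trans)
    qed (simp add: zT)
    \<comment> \<open>The images need only cluster; an ultrafilter picks a limit for all \<open>f\<close> at once.\<close>
    obtain U :: "nat filter" where U: "is_ultrafilter U" "U \<le> sequentially"
      using ultrafilter_refinement[OF trivial_limit_sequentially] by blast
    have Ub: "U \<noteq> bot" using U(1) by (simp add: is_ultrafilter_def)
    define S where "S f = Lim U (\<lambda>n. T (\<lambda>t. z n t * f t))" for f
    have zf1: "(\<lambda>t. z n t * f t) \<in> ess_ball \<mu> 1" if "f \<in> ess_ball \<mu> 1" for n f
      using ess_ball_mult[OF z(1) that, of n] by simp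
    have lim1: "\<exists>l. ((\<lambda>n. T (\<lambda>t. z n t * f t)) \<longlongrightarrow> l) U" if f: "f \<in> ess_ball \<mu> 1" for f
    proof -
      have "\<forall>\<^sub>F n in U. T (\<lambda>t. z n t * f t) \<in> closure (T ` ess_ball \<mu> 1)"
        using zf1[OF f] closure_subset by (intro always_eventually) blast
      then show ?thesis using ultrafilter_limit[OF U(1) Tc] by metis
    qed
    have lim: "((\<lambda>n. T (\<lambda>t. z n t * f t)) \<longlongrightarrow> S f) U" if f: "f \<in> ess_bounded \<mu>" for f
    proof -
      obtain c where c: "c \<ge> 0" "f \<in> ess_ball \<mu> c" using f ess_bounded_iff by blast
      define b where "b = max c 1"
      have b: "b \<ge> 1" "f \<in> ess_ball \<mu> b" using ess_ball_mono[OF c(2), of b] by (auto simp: b_def)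
      define g where "g = (\<lambda>t. complex_of_real (1 / b) * f t)"
      have "g \<in> ess_ball \<mu> (cmod (complex_of_real (1 / b)) * b)" unfolding g_def by (rule ess_ball_cmult[OF b(2)])
      then have g: "g \<in> ess_ball \<mu> 1" using b(1) by (simp add: norm_divide)
      obtain l where l: "((\<lambda>n. T (\<lambda>t. z n t * g t)) \<longlongrightarrow> l) U" using lim1[OF g] by blast
      have "T (\<lambda>t. z n t * f t) = complex_of_real b *\<^sub>C T (\<lambda>t. z n t * g t)" for n
      proof -
        have "(\<lambda>t. z n t * f t) = (\<lambda>t. complex_of_real b * (z n t * g t))" using b(1) by (auto simp: g_def)
        then show ?thesis using ess_operator_cmult[OF T ess_ball_bounded[OF zf1[OF g]]] by simp
      qed
      then have L: "((\<lambda>n. T (\<lambda>t. z n t * f t)) \<longlongrightarrow> complex_of_real b *\<^sub>C l) U"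
        using tendsto_scaleC[OF tendsto_const l, of "complex_of_real b"] by simp
      show ?thesis unfolding S_def tendsto_Lim[OF Ub L] by (rule L)
    qed
    have zfb: "(\<lambda>t. z n t * f t) \<in> ess_bounded \<mu>" if "f \<in> ess_bounded \<mu>" for n f
      by (rule ess_bounded_mult[OF ess_ball_bounded[OF z(1)] that])
    have Sadd: "S (\<lambda>t. f t + g t) = S f + S g" if f: "f \<in> ess_bounded \<mu>" and g: "g \<in> ess_bounded \<mu>" for f g
    proof (rule tendsto_unique[OF Ub lim[OF ess_bounded_add[OF f g]]])
      show "((\<lambda>n. T (\<lambda>t. z n t * (f t + g t))) \<longlongrightarrow> S f + S g) U"
        using tendsto_add[OF lim[OF f] lim[OF g]] ess_operator_add[OF T zfb[OF f] zfb[OF g]]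
        by (simp add: distrib_left)
    qed
    have Ssc: "S (\<lambda>t. a * f t) = a *\<^sub>C S f" if f: "f \<in> ess_bounded \<mu>" for f a
    proof (rule tendsto_unique[OF Ub lim[OF ess_bounded_cmult[OF f]]])
      show "((\<lambda>n. T (\<lambda>t. z n t * (a * f t))) \<longlongrightarrow> a *\<^sub>C S f) U"
        using tendsto_scaleC[OF tendsto_const lim[OF f], of a] ess_operator_cmult[OF T zfb[OF f], of a]
        by (simp add: mult.left_commute)
    qed
    have Sb: "norm (S f) \<le> N" if f: "f \<in> ess_ball \<mu> 1" for f
      by (rule tendsto_upperbound[OF tendsto_norm[OF lim[OF ess_ball_bounded[OF f]]] _ Ub])
        (simp add: TN[OF zf1[OF f]])
    have Scl: "S f \<in> closure (T ` ess_ball \<mu> 1)" if f: "f \<in> ess_ball \<mu> 1" for f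
    proof (rule Lim_in_closed_set[OF closed_closure _ Ub lim[OF ess_ball_bounded[OF f]]])
      show "\<forall>\<^sub>F n in U. T (\<lambda>t. z n t * f t) \<in> closure (T ` ess_ball \<mu> 1)"
        using zf1[OF f] closure_subset by (intro always_eventually) blast
    qed
    have S1: "norm (S (\<lambda>_. 1)) = N"
    proof (rule tendsto_unique[OF Ub])
      show "((\<lambda>n. norm (T (z n))) \<longlongrightarrow> norm (S (\<lambda>_. 1))) U"
        using tendsto_norm[OF lim[OF ess_bounded_const[of 1]]] by simp
      show "((\<lambda>n. norm (T (z n))) \<longlongrightarrow> N) U" using zlim U(2) by (rule tendsto_mono[rotated])
    qed
    have ST: "norm (S f - T f) \<le> e / 2" if f: "f \<in> ess_ball \<mu> 1" for f
      by (rule tendsto_upperbound[OF tendsto_norm[OF tendsto_diff[OF lim[OF ess_ball_bounded[OF f]] tendsto_const]] _ Ub])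
        (intro always_eventually allI near[OF f])
    define a where "a = complex_of_real (1 / N)"
    define H where "H f = a *\<^sub>C S f" for f
    have na: "cmod a = 1 / N" using N(1) by (simp add: a_def norm_divide)
    show ?thesis
    proof (intro exI[of _ H] conjI ballI impI)
      show "ess_operator \<mu> 1 H"
      proof (rule ess_operatorI)
        show "norm (H f) \<le> 1" if "f \<in> ess_ball \<mu> 1" for f
          using Sb[OF that] N(1) by (simp add: H_def norm_scaleC na)
      qed (simp_all add: H_def Sadd Ssc scaleC_add_right scaleC_scaleC mult.commute)
      have "compact (closure (S ` ess_ball \<mu> 1))"
        by (rule compact_closure_subset[OF Tc]) (use Scl in auto)
      moreover have "continuous_on UNIV (\<lambda>y :: 'y. a *\<^sub>C y)" by (intro continuous_intros)
      moreover have "H ` ess_ball \<mu> 1 = (\<lambda>y. a *\<^sub>C y) ` S ` ess_ball \<mu> 1" by (auto simp: H_def)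
      ultimately show "compact (closure (H ` ess_ball \<mu> 1))" using compact_closure_image by metis
      show "norm (H (\<lambda>_. 1)) = 1" using S1 N(1) by (simp add: H_def norm_scaleC na)
      fix f assume f: "f \<in> ess_ball \<mu> 1"
      have "H f - S f = (a - 1) *\<^sub>C S f" by (simp add: H_def scaleC_diff_left)
      moreover have "cmod (a - 1) = (N - 1) / N"
      proof -
        have "a - 1 = complex_of_real (1 / N - 1)" by (simp add: a_def)
        then have "cmod (a - 1) = \<bar>1 / N - 1\<bar>" by (simp only: norm_of_real)
        then show ?thesis using N(1) by (simp add: field_simps abs_if)
      qed
      moreover have "(N - 1) / N * norm (S f) \<le> (N - 1) / N * N" using N(1) Sb[OF f] by (intro mult_left_mono) auto
      ultimately have "norm (H f - S f) \<le> (N - 1) / N * N" by (simp only: norm_scaleC)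
      then have "norm (H f - S f) \<le> e / 4" using N d by simp
      moreover have "norm (T f - G f) \<le> e / 4"
        using P(5)[of "G f"] Gb[OF f] d mult_mono[of d "e / 4" "norm (G f)" 1] e by (simp add: T_def)
      ultimately have "norm ((H f - S f) + ((S f - T f) + (T f - G f))) \<le> e / 4 + (e / 2 + e / 4)"
        using ST[OF f] by (intro norm_triangle_mono) auto
      then show "norm (H f - G f) \<le> e" by simp
    next
      fix h assume h: "h \<in> ess_bounded \<mu>" and 0: "\<forall>g\<in>ess_bounded \<mu>. G (\<lambda>t. g t * h t) = 0"
      have "P 0 = 0" using P(4)[of 0] by simp
      then have "T (\<lambda>t. z n t * h t) = 0" for n using 0 ess_ball_bounded[OF z(1)] by (simp add: T_def)
      then have "S h = 0" using lim[OF h] tendsto_unique[OF Ub _ tendsto_const] by auto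
      then show "H h = 0" by (simp add: H_def)
    qed
  qed
  with \<eta>(1) show ?thesis by (rule that)
qed

text \<open>
  On \<open>cmod u > 1 - b\<close> the function \<open>u\<close> is replaced by its phase. The operator \<open>G\<close>, twisted by
  this phase and cut off to this set, almost attains its norm at \<open>1\<close>; the operator found there is
  twisted back. As it ignores the values off the set, the new norming point may agree with \<open>u\<close>
  there.
\<close>

lemma bpb_rse_ess_operator:
  assumes Y: "C_uniformly_convex TYPE('y::complex_banach)" and e: "e > 0"
  obtains \<eta> where "\<eta> > 0"
    "\<And>(G :: ('a \<Rightarrow> complex) \<Rightarrow> 'y) u. ess_operator \<mu> 1 G \<Longrightarrow> compact (closure (G ` ess_ball \<mu> 1)) \<Longrightarrow>
      u \<in> ess_ball \<mu> 1 \<Longrightarrow> norm (G u) > 1 - \<eta> \<Longrightarrow>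
      \<exists>H x0. ess_operator \<mu> 1 H \<and> compact (closure (H ` ess_ball \<mu> 1)) \<and> x0 \<in> ess_ball \<mu> 1 \<and> norm (H x0) = 1 \<and>
        (\<forall>f\<in>ess_ball \<mu> 1. norm (H f - G f) \<le> e) \<and> (\<lambda>t. u t - x0 t) \<in> ess_ball \<mu> e \<and>
        range_exposing \<mu> H x0"
proof -
  have e3: "e / 3 > 0" using e by simp
  obtain \<eta>1 where \<eta>1: "\<eta>1 > 0"
    "\<And>G :: ('a \<Rightarrow> complex) \<Rightarrow> 'y. ess_operator \<mu> 1 G \<Longrightarrow> compact (closure (G ` ess_ball \<mu> 1)) \<Longrightarrow>
      norm (G (\<lambda>_. 1)) > 1 - \<eta>1 \<Longrightarrow>
      \<exists>H. ess_operator \<mu> 1 H \<and> compact (closure (H ` ess_ball \<mu> 1)) \<and> norm (H (\<lambda>_. 1)) = 1 \<and>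
        (\<forall>f\<in>ess_ball \<mu> 1. norm (H f - G f) \<le> e / 3) \<and>
        (\<forall>h\<in>ess_bounded \<mu>. (\<forall>g\<in>ess_bounded \<mu>. G (\<lambda>t. g t * h t) = 0) \<longrightarrow> H h = 0)"
    using perturb_to_attain_at_one[OF Y e3] by blast
  define \<epsilon> where "\<epsilon> = min (e / 3) (\<eta>1 / 3)"
  define b where "b = min \<epsilon> (1 / 2)"
  have \<epsilon>: "\<epsilon> > 0" "\<epsilon> \<le> e / 3" "\<epsilon> \<le> \<eta>1 / 3" using e \<eta>1(1) by (auto simp: \<epsilon>_def)
  have b: "b > 0" "b \<le> \<epsilon>" "b < 1" using \<epsilon> by (auto simp: b_def)
  have "b * \<epsilon> > 0" using b \<epsilon> by simp
  then obtain d where d: "d > 0"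
    "\<And>(G :: ('a \<Rightarrow> complex) \<Rightarrow> 'y) g h. ess_operator \<mu> 1 G \<Longrightarrow> g \<in> ess_bounded \<mu> \<Longrightarrow> h \<in> ess_bounded \<mu> \<Longrightarrow>
      AE t in \<mu>. cmod (g t) + cmod (h t) \<le> 1 \<Longrightarrow> norm (G g) \<ge> 1 - d \<Longrightarrow> norm (G h) \<le> b * \<epsilon>"
    using small_on_slack_of_near_norming[OF Y] by blast
  define \<eta> where "\<eta> = min d (\<eta>1 / 3)"
  have \<eta>: "\<eta> > 0" "\<eta> \<le> d" "\<eta> \<le> \<eta>1 / 3" using d(1) \<eta>1(1) by (auto simp: \<eta>_def)
  have "\<exists>H x0. ess_operator \<mu> 1 H \<and> compact (closure (H ` ess_ball \<mu> 1)) \<and> x0 \<in> ess_ball \<mu> 1 \<and> norm (H x0) = 1 \<and>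
        (\<forall>f\<in>ess_ball \<mu> 1. norm (H f - G f) \<le> e) \<and> (\<lambda>t. u t - x0 t) \<in> ess_ball \<mu> e \<and>
        range_exposing \<mu> H x0"
    if G: "ess_operator \<mu> 1 G" and cp: "compact (closure (G ` ess_ball \<mu> 1))"
      and u: "u \<in> ess_ball \<mu> 1" and Gu: "norm (G u) > 1 - \<eta>" for G :: "('a \<Rightarrow> complex) \<Rightarrow> 'y" and u
  proof -
    note [measurable] = ess_ball_measurable[OF u]
    define a where "a t = (if cmod (u t) > 1 - b then sgn (u t) else 0)" for t
    define off where "off t = (if cmod (u t) > 1 - b then 0 else (1::complex))" for t
    define x0 where "x0 t = (if cmod (u t) > 1 - b then sgn (u t) else u t)" for t
    have [measurable]: "a \<in> borel_measurable \<mu>" unfolding a_def sgn_eq by measurable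
    have [measurable]: "off \<in> borel_measurable \<mu>" unfolding off_def by measurable
    have x0m [measurable]: "x0 \<in> borel_measurable \<mu>" unfolding x0_def sgn_eq by measurable
    have nz: "u t \<noteq> 0" if "cmod (u t) > 1 - b" for t using that b by auto
    have a: "a \<in> ess_ball \<mu> 1" by (rule ess_ballI) (auto simp: a_def norm_sgn)
    have "(\<lambda>t. cnj (a t)) \<in> borel_measurable \<mu>"
      by (rule borel_measurable_continuous_on[where f = cnj]) (auto intro: continuous_intros)
    then have ca: "(\<lambda>t. cnj (a t)) \<in> ess_ball \<mu> 1" by (rule ess_ballI) (auto simp: a_def norm_sgn)
    have off: "off \<in> ess_ball \<mu> 1" by (rule ess_ballI) (auto simp: off_def)
    have x0: "x0 \<in> ess_ball \<mu> 1"
    proof (rule ess_ballI[OF x0m])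
      show "AE t in \<mu>. cmod (x0 t) \<le> 1"
        using ess_ball_AE[OF u] by eventually_elim (auto simp: x0_def norm_sgn)
    qed
    have aca: "a t * cnj (a t) = 1 - off t" "cnj (a t) * x0 t = 1 - off t + off t * (cnj (a t) * x0 t)"
      "off t * a t = 0" for t
      using nz[of t] by (auto simp: a_def off_def x0_def complex_norm_square[symmetric] norm_sgn mult.commute[of "cnj _"])
    have mball: "(\<lambda>t. p t * f t) \<in> ess_ball \<mu> 1" if "p \<in> ess_ball \<mu> 1" "f \<in> ess_ball \<mu> 1" for p f
      using ess_ball_mult[OF that] by simp
    have Goff: "norm (G (\<lambda>t. off t * f t)) \<le> \<epsilon>" if f: "f \<in> ess_ball \<mu> 1" for f
    proof -
      have of: "(\<lambda>t. off t * f t) \<in> ess_bounded \<mu>" by (rule ess_ball_bounded[OF mball[OF off f]])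
      have "norm (G (\<lambda>t. complex_of_real b * (off t * f t))) \<le> b * \<epsilon>"
      proof (rule d(2)[OF G ess_ball_bounded[OF u] ess_bounded_cmult[OF of]])
        show "AE t in \<mu>. cmod (u t) + cmod (complex_of_real b * (off t * f t)) \<le> 1"
          using ess_ball_AE[OF u] ess_ball_AE[OF f]
        proof eventually_elim
          case (elim t)
          have "b * cmod (f t) \<le> b * 1" using elim b by (intro mult_left_mono) auto
          moreover have "cmod (complex_of_real b * (off t * f t)) = (if cmod (u t) > 1 - b then 0 else b * cmod (f t))"
            using b by (simp add: off_def norm_mult)
          ultimately have "cmod (complex_of_real b * (off t * f t)) \<le> (if cmod (u t) > 1 - b then 0 else b)"
            by (simp only: mult_1_right split: if_splits) simp_all
          moreover have "x + n \<le> 1" if "n \<le> (if x > 1 - b then 0 else b)" "x \<le> 1" for x n :: real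
            using that by (auto split: if_splits)
          ultimately show ?case using elim(1) by blast
        qed
        show "1 - d \<le> norm (G u)" using Gu \<eta> by simp
      qed
      then have "b * norm (G (\<lambda>t. off t * f t)) \<le> b * \<epsilon>"
        using b by (simp add: ess_operator_cmult[OF G of] norm_scaleC)
      then show ?thesis using b by simp
    qed
    have ux0: "AE t in \<mu>. cmod (u t - x0 t) \<le> b"
      using ess_ball_AE[OF u]
    proof eventually_elim
      case (elim t)
      show ?case
      proof (cases "cmod (u t) > 1 - b")
        case True
        have "u t - x0 t = complex_of_real (cmod (u t) - 1) * sgn (u t)"
          using True nz[OF True] by (simp add: x0_def sgn_eq field_simps)
        then have "cmod (u t - x0 t) = \<bar>cmod (u t) - 1\<bar>"
          using nz[OF True] by (simp add: norm_mult norm_sgn del: of_real_diff)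
        then show ?thesis using elim True by simp
      next
        case False
        then show ?thesis using b by (simp add: x0_def)
      qed
    qed
    have ux0b: "(\<lambda>t. u t - x0 t) \<in> ess_ball \<mu> b" by (rule ess_ballI[OF _ ux0]) simp
    have x0a: "x0 = (\<lambda>t. a t + off t * u t)" by (auto simp: x0_def a_def off_def)
    have Ga: "norm (G a) > 1 - \<eta>1"
    proof -
      have "u = (\<lambda>t. (u t - x0 t) + (a t + off t * u t))" by (subst x0a) auto
      then have "G u = G (\<lambda>t. u t - x0 t) + (G a + G (\<lambda>t. off t * u t))"
        using ess_operator_add[OF G ess_ball_bounded[OF ux0b] ess_bounded_add[OF ess_ball_bounded[OF a] ess_ball_bounded[OF mball[OF off u]]]]
          ess_operator_add[OF G ess_ball_bounded[OF a] ess_ball_bounded[OF mball[OF off u]]] by metis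
      then have "norm (G u) \<le> norm (G (\<lambda>t. u t - x0 t)) + (norm (G a) + norm (G (\<lambda>t. off t * u t)))"
        by (simp add: norm_triangle_mono norm_triangle_ineq)
      then show ?thesis
        using ess_operator_bound[OF G ux0b] b \<epsilon> \<eta> Goff[OF u] Gu by simp
    qed
    define G1 where "G1 f = G (\<lambda>t. a t * f t)" for f
    have afb: "(\<lambda>t. a t * f t) \<in> ess_bounded \<mu>" if "f \<in> ess_bounded \<mu>" for f
      by (rule ess_bounded_mult[OF ess_ball_bounded[OF a] that])
    have G1: "ess_operator \<mu> 1 G1"
    proof (rule ess_operatorI)
      show "norm (G1 f) \<le> 1" if "f \<in> ess_ball \<mu> 1" for f
        using ess_operator_bound[OF G mball[OF a that]] by (simp add: G1_def)
      show "G1 (\<lambda>t. f t + g t) = G1 f + G1 g" if "f \<in> ess_bounded \<mu>" "g \<in> ess_bounded \<mu>" for f g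
        using ess_operator_add[OF G afb[OF that(1)] afb[OF that(2)]] by (simp add: G1_def distrib_left)
      show "G1 (\<lambda>t. c * f t) = c *\<^sub>C G1 f" if "f \<in> ess_bounded \<mu>" for f c
        using ess_operator_cmult[OF G afb[OF that], of c] by (simp add: G1_def mult.left_commute)
    qed
    have "compact (closure (G1 ` ess_ball \<mu> 1))"
      by (rule compact_closure_subset[OF cp])
        (use mball[OF a] closure_subset[of "G ` ess_ball \<mu> 1"] in \<open>auto simp: G1_def\<close>)
    moreover have "norm (G1 (\<lambda>_. 1)) > 1 - \<eta>1" using Ga by (simp add: G1_def)
    ultimately obtain H0 where H0: "ess_operator \<mu> 1 H0" "compact (closure (H0 ` ess_ball \<mu> 1))" "norm (H0 (\<lambda>_. 1)) = 1"
      "\<And>f. f\<in>ess_ball \<mu> 1 \<Longrightarrow> norm (H0 f - G1 f) \<le> e / 3"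
      "\<And>h. h\<in>ess_bounded \<mu> \<Longrightarrow> (\<And>g. g\<in>ess_bounded \<mu> \<Longrightarrow> G1 (\<lambda>t. g t * h t) = 0) \<Longrightarrow> H0 h = 0"
      using \<eta>1(2)[OF G1] by blast
    obtain H1 where H1: "ess_operator \<mu> 1 H1" "compact (closure (H1 ` ess_ball \<mu> 1))" "norm (H1 (\<lambda>_. 1)) = 1"
      "\<And>f. f \<in> ess_ball \<mu> 1 \<Longrightarrow> norm (H1 f - H0 f) \<le> e / 3"
      "\<And>f. H0 f = 0 \<Longrightarrow> H1 f = 0"
      "range_exposing \<mu> H1 (\<lambda>_. 1)"
      using perturb_to_exposing_at_one[OF Y e3 H0(1,2,3)] by blast
    have G0: "G (\<lambda>t. 0) = 0" using ess_operator_bound[OF G ess_ball_const[of 0 0]] by simp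
    \<comment> \<open>The perturbations ignore what happens off the set, because \<open>G1\<close> does.\<close>
    have H1off: "H1 (\<lambda>t. off t * h t) = 0" if h: "h \<in> ess_bounded \<mu>" for h
    proof (rule H1(5), rule H0(5))
      show "(\<lambda>t. off t * h t) \<in> ess_bounded \<mu>" by (rule ess_bounded_mult[OF ess_ball_bounded[OF off] h])
      fix g
      have "(\<lambda>t. a t * (g t * (off t * h t))) = (\<lambda>t. 0)" using aca(3) by (auto simp: fun_eq_iff)
      then show "G1 (\<lambda>t. g t * (off t * h t)) = 0" by (simp only: G1_def G0)
    qed
    define H where "H f = H1 (\<lambda>t. cnj (a t) * f t)" for f
    have cb: "(\<lambda>t. cnj (a t) * f t) \<in> ess_ball \<mu> 1" if "f \<in> ess_ball \<mu> 1" for f using mball[OF ca that] .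
    have cfb: "(\<lambda>t. cnj (a t) * f t) \<in> ess_bounded \<mu>" if "f \<in> ess_bounded \<mu>" for f
      by (rule ess_bounded_mult[OF ess_ball_bounded[OF ca] that])
    have Hx0: "H x0 = H1 (\<lambda>_. 1)"
    proof -
      define h where "h = (\<lambda>t. cnj (a t) * x0 t - 1)"
      have h: "h \<in> ess_bounded \<mu>" unfolding h_def
        by (rule ess_bounded_diff[OF cfb[OF ess_ball_bounded[OF x0]] ess_bounded_const])
      have "(\<lambda>t. cnj (a t) * x0 t) = (\<lambda>t. 1 + off t * h t)"
      proof
        fix t show "cnj (a t) * x0 t = 1 + off t * h t"
          using aca(2)[of t] by (simp add: h_def algebra_simps)
      qed
      then have "H x0 = H1 (\<lambda>_. 1) + H1 (\<lambda>t. off t * h t)"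
        unfolding H_def
        using ess_operator_add[OF H1(1) ess_bounded_const[of 1] ess_bounded_mult[OF ess_ball_bounded[OF off] h]] by metis
      then show ?thesis using H1off[OF h] by simp
    qed
    show ?thesis
    proof (intro exI[of _ H] exI[of _ x0] conjI ballI allI impI)
      show "ess_operator \<mu> 1 H"
      proof (rule ess_operatorI)
        show "norm (H f) \<le> 1" if "f \<in> ess_ball \<mu> 1" for f
          using ess_operator_bound[OF H1(1) cb[OF that]] by (simp add: H_def)
        show "H (\<lambda>t. f t + g t) = H f + H g" if "f \<in> ess_bounded \<mu>" "g \<in> ess_bounded \<mu>" for f g
          using ess_operator_add[OF H1(1) cfb[OF that(1)] cfb[OF that(2)]] by (simp add: H_def distrib_left)
        show "H (\<lambda>t. c * f t) = c *\<^sub>C H f" if "f \<in> ess_bounded \<mu>" for f c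
          using ess_operator_cmult[OF H1(1) cfb[OF that], of c] by (simp add: H_def mult.left_commute)
      qed
      show "compact (closure (H ` ess_ball \<mu> 1))"
        by (rule compact_closure_subset[OF H1(2)])
          (use cb closure_subset[of "H1 ` ess_ball \<mu> 1"] in \<open>auto simp: H_def\<close>)
      show "x0 \<in> ess_ball \<mu> 1" by (rule x0)
      show "norm (H x0) = 1" using Hx0 H1(3) by simp
      show "(\<lambda>t. u t - x0 t) \<in> ess_ball \<mu> e" by (rule ess_ball_mono[OF ux0b]) (use b \<epsilon> e in simp)
    next
      fix f assume f: "f \<in> ess_ball \<mu> 1"
      let ?g = "\<lambda>t. cnj (a t) * f t"
      have "G1 ?g = G (\<lambda>t. f t - off t * f t)"
        unfolding G1_def by (simp add: mult.assoc[symmetric] aca(1) left_diff_distrib)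
      also have "\<dots> = G f - G (\<lambda>t. off t * f t)"
        by (rule ess_operator_diff[OF G ess_ball_bounded[OF f] ess_ball_bounded[OF mball[OF off f]]])
      finally have "norm (G1 ?g - G f) \<le> e / 3" using Goff[OF f] \<epsilon> by simp
      then have "norm ((H1 ?g - H0 ?g) + ((H0 ?g - G1 ?g) + (G1 ?g - G f))) \<le> e / 3 + (e / 3 + e / 3)"
        using H1(4)[OF cb[OF f]] H0(4)[OF cb[OF f]] by (intro norm_triangle_mono) auto
      then show "norm (H f - G f) \<le> e" by (simp add: H_def)
    next
      show "range_exposing \<mu> H x0"
        unfolding range_exposing_def
      proof (intro allI impI)
        fix x assume x: "(\<forall>n. x n \<in> ess_ball \<mu> 1) \<and> (\<lambda>n. norm (H (x n))) \<longlonglongrightarrow> 1"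
        define y where "y n = (\<lambda>t. cnj (a t) * x n t)" for n
        have "y n \<in> ess_ball \<mu> 1" for n using x cb by (simp add: y_def)
        moreover have Hy: "H (x n) = H1 (y n)" for n by (simp add: H_def y_def)
        ultimately show "\<exists>\<sigma> c. strict_mono (\<sigma> :: nat \<Rightarrow> nat) \<and> cmod c = 1 \<and> (\<lambda>n. H (x (\<sigma> n))) \<longlonglongrightarrow> c *\<^sub>C H x0"
          using H1(6) x unfolding range_exposing_def Hx0 Hy by blast
      qed
    qed
  qed
  with \<eta>(1) show ?thesis by (rule that)
qed

section \<open>Functionals and non-null sets\<close>

text \<open>
  A limit along an ultrafilter that contains \<open>E\<close> and refines the filter of co-null sets. Integral
  averages would be unavailable, since \<open>E\<close> may have no subset of finite positive measure.
\<close>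

lemma ultralimit_functional:
  assumes E: "\<not> (AE t in \<mu>. t \<notin> E)"
  obtains \<phi> :: "('a \<Rightarrow> complex) \<Rightarrow> complex" where
    "\<And>f g. f \<in> ess_bounded \<mu> \<Longrightarrow> g \<in> ess_bounded \<mu> \<Longrightarrow> \<phi> (\<lambda>t. f t + g t) = \<phi> f + \<phi> g"
    "\<And>a f. f \<in> ess_bounded \<mu> \<Longrightarrow> \<phi> (\<lambda>t. a * f t) = a * \<phi> f"
    "\<And>f. f \<in> ess_ball \<mu> 1 \<Longrightarrow> cmod (\<phi> f) \<le> 1"
    "\<And>f z. (\<And>t. t \<in> E \<Longrightarrow> f t = z) \<Longrightarrow> \<phi> f = z"
proof -
  have "inf (ae_filter \<mu>) (principal E) \<noteq> bot"
    using E by (simp add: trivial_limit_def eventually_inf_principal)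
  then obtain U where U: "is_ultrafilter U" "U \<le> inf (ae_filter \<mu>) (principal E)" by (rule ultrafilter_refinement)
  have Ub: "U \<noteq> bot" using U(1) by (simp add: is_ultrafilter_def)
  have ae: "eventually P U" if "AE t in \<mu>. P t" for P
    using U(2) that by (meson filter_leD le_inf_iff)
  have inE: "eventually (\<lambda>t. t \<in> E) U"
    using U(2) by (meson eventually_principal filter_leD le_inf_iff)
  define \<phi> where "\<phi> f = Lim U f" for f :: "'a \<Rightarrow> complex"
  have lim: "(f \<longlongrightarrow> \<phi> f) U" if f: "f \<in> ess_bounded \<mu>" for f
  proof -
    obtain c where c: "f \<in> ess_ball \<mu> c" using f ess_bounded_iff by blast
    have "eventually (\<lambda>t. f t \<in> cball 0 c) U" using ae[OF ess_ball_AE[OF c]] by simp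
    then obtain l where l: "(f \<longlongrightarrow> l) U" by (rule ultrafilter_limit[OF U(1) compact_cball])
    show ?thesis unfolding \<phi>_def tendsto_Lim[OF Ub l] by (rule l)
  qed
  show ?thesis
  proof (rule that[of \<phi>])
    show "\<phi> (\<lambda>t. f t + g t) = \<phi> f + \<phi> g" if "f \<in> ess_bounded \<mu>" "g \<in> ess_bounded \<mu>" for f g
      using tendsto_Lim[OF Ub tendsto_add[OF lim[OF that(1)] lim[OF that(2)]]] by (simp add: \<phi>_def)
    show "\<phi> (\<lambda>t. a * f t) = a * \<phi> f" if "f \<in> ess_bounded \<mu>" for a f
      using tendsto_Lim[OF Ub tendsto_mult_left[OF lim[OF that]]] by (simp add: \<phi>_def)
    show "cmod (\<phi> f) \<le> 1" if f: "f \<in> ess_ball \<mu> 1" for f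
      by (rule tendsto_upperbound[OF tendsto_norm[OF lim[OF ess_ball_bounded[OF f]]] ae[OF ess_ball_AE[OF f]] Ub])
    show "\<phi> f = z" if "\<And>t. t \<in> E \<Longrightarrow> f t = z" for f z
    proof -
      have "eventually (\<lambda>t. f t = z) U" using inE by eventually_elim (rule that)
      then have "(f \<longlongrightarrow> z) U" by (rule tendsto_eventually)
      then show ?thesis unfolding \<phi>_def by (rule tendsto_Lim[OF Ub])
    qed
  qed
qed

text \<open>
  If every measurable set is null or co-null, then \<open>f\<close> equals its limit along any ultrafilter
  refining the filter of co-null sets.
\<close>

lemma ess_bounded_AE_const:
  assumes triv: "\<And>A. A \<in> sets \<mu> \<Longrightarrow> (AE t in \<mu>. t \<in> A) \<or> (AE t in \<mu>. t \<notin> A)"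
    and f: "f \<in> ess_bounded \<mu>"
  obtains l where "AE t in \<mu>. f t = l"
proof (cases "ae_filter \<mu> = bot")
  case True
  then have "AE t in \<mu>. f t = 0" by (simp add: trivial_limit_def eventually_mono)
  then show ?thesis by (rule that)
next
  case False
  then obtain U where U: "is_ultrafilter U" "U \<le> ae_filter \<mu>" by (rule ultrafilter_refinement)
  obtain c where c: "f \<in> ess_ball \<mu> c" using f ess_bounded_iff by blast
  note [measurable] = ess_bounded_measurable[OF f]
  have "eventually (\<lambda>t. f t \<in> cball 0 c) U" using filter_leD[OF U(2) ess_ball_AE[OF c]] by simp
  then obtain l where l: "(f \<longlongrightarrow> l) U" by (rule ultrafilter_limit[OF U(1) compact_cball])
  have "AE t in \<mu>. dist (f t) l < 1 / real (Suc n)" for n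
  proof -
    define A where "A = {t \<in> space \<mu>. dist (f t) l < 1 / real (Suc n)}"
    have "A \<in> sets \<mu>" unfolding A_def by measurable
    moreover have "\<not> (AE t in \<mu>. t \<notin> A)"
    proof
      assume "AE t in \<mu>. t \<notin> A"
      then have "AE t in \<mu>. \<not> dist (f t) l < 1 / real (Suc n)"
        using AE_space by eventually_elim (auto simp: A_def)
      then have "eventually (\<lambda>t. \<not> dist (f t) l < 1 / real (Suc n)) U" by (rule filter_leD[OF U(2)])
      moreover have "eventually (\<lambda>t. dist (f t) l < 1 / real (Suc n)) U" by (rule tendstoD[OF l]) simp
      ultimately have "eventually (\<lambda>t. False) U" by eventually_elim simp
      then show False using U(1) by (simp add: is_ultrafilter_def)
    qed
    ultimately have "AE t in \<mu>. t \<in> A" using triv by blast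
    then show ?thesis by eventually_elim (simp add: A_def)
  qed
  then have "AE t in \<mu>. \<forall>n. dist (f t) l < 1 / real (Suc n)" by (simp add: AE_all_countable)
  then have "AE t in \<mu>. f t = l"
  proof eventually_elim
    case (elim t)
    show ?case
    proof (rule ccontr)
      assume "f t \<noteq> l"
      then obtain n where "1 / real (Suc n) < dist (f t) l" using nat_approx_posE[of "dist (f t) l"] by auto
      then show False using elim[rule_format, of n] by simp
    qed
  qed
  then show ?thesis by (rule that)
qed

lemma dim_ge_two_split:
  assumes "dim_ge_two (Linf \<mu>)"
  obtains A where "A \<in> sets \<mu>" "\<not> (AE t in \<mu>. t \<in> A)" "\<not> (AE t in \<mu>. t \<notin> A)"
proof (rule ccontr)
  assume "\<not> thesis"
  with that have triv: "\<And>A. A \<in> sets \<mu> \<Longrightarrow> (AE t in \<mu>. t \<in> A) \<or> (AE t in \<mu>. t \<notin> A)" by blast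
  obtain f g where f: "f \<in> ess_bounded \<mu>" and g: "g \<in> ess_bounded \<mu>" and
    ind: "\<And>a b. cs_add (Linf \<mu>) (cs_smult (Linf \<mu>) a (ae_class \<mu> f)) (cs_smult (Linf \<mu>) b (ae_class \<mu> g)) = cs_zero (Linf \<mu>) \<Longrightarrow> a = 0 \<and> b = 0"
    using assms unfolding dim_ge_two_def Linf_carrier by blast
  note [measurable] = ess_bounded_measurable[OF f] ess_bounded_measurable[OF g]
  have ind': "a = 0 \<and> b = 0" if "AE t in \<mu>. a * f t + b * g t = 0" for a b
  proof (rule ind)
    have "ae_class \<mu> (\<lambda>t. a * f t + b * g t) = ae_class \<mu> (\<lambda>_. 0)"
      using that by (subst ae_class_eq_iff) auto
    then show "cs_add (Linf \<mu>) (cs_smult (Linf \<mu>) a (ae_class \<mu> f)) (cs_smult (Linf \<mu>) b (ae_class \<mu> g)) = cs_zero (Linf \<mu>)"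
      by (simp add: Linf_smult Linf_add) (simp add: Linf_def)
  qed
  obtain p where p: "AE t in \<mu>. f t = p" using ess_bounded_AE_const[OF triv f] by blast
  obtain q where q: "AE t in \<mu>. g t = q" using ess_bounded_AE_const[OF triv g] by blast
  have "AE t in \<mu>. q * f t + (- p) * g t = 0" using p q by eventually_elim simp
  from ind'[OF this] have "p = 0" by simp
  then have "AE t in \<mu>. 1 * f t + 0 * g t = 0" using p by simp
  from ind'[OF this] show False by simp
qed

section \<open>Norming vectors of range strongly exposing operators\<close>

lemma unimodular_sum_two:
  assumes "cmod a = 1" "cmod b = 1" "a + b = 2"
  shows "a = 1"
proof -
  have "Re a \<le> 1" "Re b \<le> 1" using complex_Re_le_cmod[of a] complex_Re_le_cmod[of b] assms by auto
  moreover have "Re a + Re b = 2" using arg_cong[OF assms(3), of Re] by simp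
  ultimately have "Re a = 1" by linarith
  moreover from this have "Im a = 0" using assms(1) cmod_power2[of a] by simp
  ultimately show ?thesis by (simp add: complex_eq_iff)
qed

text \<open>
  Each point of the disc is the midpoint of two unimodular numbers, so each
  point of the bidisc is the midpoint of two points of the torus, where a rotation reduces to the
  hypothesis.
\<close>

lemma norm_bidisc_le:
  fixes y0 y1 :: "'y::complex_banach"
  assumes y: "\<And>w. cmod w = 1 \<Longrightarrow> norm (y0 + w *\<^sub>C y1) \<le> 1" and a: "cmod a \<le> 1" and b: "cmod b \<le> 1"
  shows "norm (a *\<^sub>C y0 + b *\<^sub>C y1) \<le> 1"
proof -
  have unit: "\<exists>u v. cmod u = 1 \<and> cmod v = 1 \<and> z = (1/2) * (u + v)" if z: "cmod z \<le> 1" for z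
  proof (cases "z = 0")
    case True
    then show ?thesis by (intro exI[of _ 1] exI[of _ "-1"]) simp
  next
    case False
    define r where "r = cmod z"
    have r: "0 < r" "r \<le> 1" using False z by (auto simp: r_def)
    define p where "p = Complex r (sqrt (1 - r\<^sup>2))"
    have "r\<^sup>2 \<le> 1" using r by (simp add: power_le_one)
    then have p: "cmod p = 1" "cmod (cnj p) = 1" by (simp_all add: p_def cmod_def)
    have s: "cmod (sgn z) = 1" using False by (simp add: norm_sgn)
    have "p + cnj p = 2 * complex_of_real r" by (simp add: p_def complex_eq_iff)
    then have "(1/2) * (sgn z * p + sgn z * cnj p) = sgn z * complex_of_real r"
      by (simp add: distrib_left[symmetric])
    also have "\<dots> = z" using False by (simp add: r_def sgn_eq)
    finally show ?thesis using p s by (intro exI[of _ "sgn z * p"] exI[of _ "sgn z * cnj p"]) (simp add: norm_mult)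
  qed
  have corner: "norm (u *\<^sub>C y0 + v *\<^sub>C y1) \<le> 1" if "cmod u = 1" "cmod v = 1" for u v
  proof -
    have "u *\<^sub>C (y0 + (v / u) *\<^sub>C y1) = u *\<^sub>C y0 + v *\<^sub>C y1"
      using that by (auto simp: scaleC_add_right scaleC_scaleC)
    moreover have "norm (y0 + (v / u) *\<^sub>C y1) \<le> 1" using that by (intro y) (simp add: norm_divide)
    ultimately show ?thesis using norm_scaleC[of u "y0 + (v / u) *\<^sub>C y1"] that by simp
  qed
  have half: "norm ((1/2) *\<^sub>C (p + q)) \<le> 1" if "norm p \<le> 1" "norm q \<le> 1" for p q :: 'y
    using norm_triangle_ineq[of p q] that by (simp add: norm_scaleC)
  obtain u v where u: "cmod u = 1" "cmod v = 1" "a = (1/2) * (u + v)" using unit[OF a] by blast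
  obtain u' v' where u': "cmod u' = 1" "cmod v' = 1" "b = (1/2) * (u' + v')" using unit[OF b] by blast
  have "a *\<^sub>C y0 + b *\<^sub>C y1 = (1/2) *\<^sub>C ((u *\<^sub>C y0 + u' *\<^sub>C y1) + (v *\<^sub>C y0 + v' *\<^sub>C y1))"
    unfolding u(3) u'(3) by (simp only: scaleC_scaleC[symmetric] scaleC_add_left scaleC_add_right add_ac)
  then show ?thesis using half[OF corner[OF u(1) u'(1)] corner[OF u(2) u'(2)]] by simp
qed

text \<open>
  Constant sequences are admissible in the definition of \<open>RSE\<close>.
\<close>

lemma RSE_norming_circle:
  assumes S: "S \<in> RSE X" and x: "x \<in> unit_ball X" "norm (S x) = opnorm X S"
    and y: "y \<in> unit_ball X" "norm (S y) = opnorm X S"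
  obtains c where "cmod c = 1" "S y = c *\<^sub>C S x"
proof -
  obtain x0 where x0: "\<And>x :: nat \<Rightarrow> _. (\<forall>n. x n \<in> unit_ball X) \<Longrightarrow> (\<lambda>n. norm (S (x n))) \<longlonglongrightarrow> opnorm X S \<Longrightarrow>
     (\<exists>\<sigma> c. strict_mono (\<sigma> :: nat \<Rightarrow> nat) \<and> cmod c = 1 \<and> (\<lambda>n. S (x (\<sigma> n))) \<longlonglongrightarrow> c *\<^sub>C S x0)"
    using S unfolding RSE_def by blast
  have *: "\<exists>c. cmod c = 1 \<and> S z = c *\<^sub>C S x0" if "z \<in> unit_ball X" "norm (S z) = opnorm X S" for z
    using x0[of "\<lambda>_. z"] that by (auto simp: LIMSEQ_const_iff)
  obtain c where c: "cmod c = 1" "S x = c *\<^sub>C S x0" using *[OF x] by blast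
  obtain d where d: "cmod d = 1" "S y = d *\<^sub>C S x0" using *[OF y] by blast
  have "c \<noteq> 0" using c(1) by auto
  then have "S y = (d / c) *\<^sub>C S x" by (simp add: c(2) d(2) scaleC_scaleC)
  moreover have "cmod (d / c) = 1" using c d by (simp add: norm_divide)
  ultimately show ?thesis using that by blast
qed

lemma Linf_diff:
  assumes "f \<in> ess_bounded \<mu>" "g \<in> ess_bounded \<mu>"
  shows "cs_diff (Linf \<mu>) (ae_class \<mu> f) (ae_class \<mu> g) = ae_class \<mu> (\<lambda>t. f t - g t)"
  using assms ess_bounded_measurable[OF ess_bounded_cmult[OF assms(2), of "-1"]]
  by (simp add: cs_diff_def Linf_smult Linf_add ess_bounded_measurable)

text \<open>
  The vector \<open>S f\<close> of norm one is the midpoint of \<open>S (f + g)\<close> and \<open>S (f - g)\<close>, which therefore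
  have norm one and are unimodular multiples \<open>a, b\<close> of \<open>S f\<close>. Then \<open>a + b = 2\<close>, so both are
  \<open>1\<close>.
\<close>

lemma RSE_kills_small_support:
  assumes S: "S \<in> RSE (Linf \<mu>)" and S1: "opnorm (Linf \<mu>) S = 1" "norm (S (ae_class \<mu> f)) = 1"
    and f: "f \<in> ess_ball \<mu> 1" and g: "g \<in> ess_bounded \<mu>"
    and fg: "AE t in \<mu>. cmod (f t) + cmod (g t) \<le> 1"
  shows "S (ae_class \<mu> g) = 0"
proof -
  have "S \<in> bounded_ops (Linf \<mu>)" using S by (simp add: RSE_def)
  then have H: "ess_operator \<mu> 1 (\<lambda>f. S (ae_class \<mu> f))" using ess_operator_opnorm S1(1) by fastforce
  have fb: "f \<in> ess_bounded \<mu>" by (rule ess_ball_bounded[OF f])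
  define v where "v = S (ae_class \<mu> f)"
  define p where "p = (\<lambda>t. f t + g t)"
  define q where "q = (\<lambda>t. f t - g t)"
  have p: "p \<in> ess_ball \<mu> 1"
  proof (rule ess_ballI)
    show "p \<in> borel_measurable \<mu>" unfolding p_def by (rule ess_bounded_measurable[OF ess_bounded_add[OF fb g]])
    show "AE t in \<mu>. cmod (p t) \<le> 1" using fg by eventually_elim (simp add: p_def norm_triangle_le)
  qed
  have q: "q \<in> ess_ball \<mu> 1"
  proof (rule ess_ballI)
    show "q \<in> borel_measurable \<mu>" unfolding q_def by (rule ess_bounded_measurable[OF ess_bounded_diff[OF fb g]])
    show "AE t in \<mu>. cmod (q t) \<le> 1" using fg by eventually_elim (simp add: q_def norm_triangle_le_diff)
  qed
  have Sp: "S (ae_class \<mu> p) = v + S (ae_class \<mu> g)" and Sq: "S (ae_class \<mu> q) = v - S (ae_class \<mu> g)"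
    unfolding p_def q_def v_def by (rule ess_operator_add[OF H fb g], rule ess_operator_diff[OF H fb g])
  have "norm (S (ae_class \<mu> p) + S (ae_class \<mu> q)) = 2"
  proof -
    have "S (ae_class \<mu> p) + S (ae_class \<mu> q) = 2 *\<^sub>R v" unfolding Sp Sq by (simp add: scaleR_2)
    then show ?thesis using S1(2) by (simp add: v_def)
  qed
  moreover have "norm (S (ae_class \<mu> p)) \<le> 1" "norm (S (ae_class \<mu> q)) \<le> 1"
    using ess_operator_bound[OF H p] ess_operator_bound[OF H q] by auto
  ultimately have n: "norm (S (ae_class \<mu> p)) = 1" "norm (S (ae_class \<mu> q)) = 1"
    using norm_triangle_ineq[of "S (ae_class \<mu> p)" "S (ae_class \<mu> q)"] by linarith+
  have ball: "ae_class \<mu> h \<in> unit_ball (Linf \<mu>)" if "h \<in> ess_ball \<mu> 1" for h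
    using that by (simp add: unit_ball_Linf)
  obtain a where a: "cmod a = 1" "S (ae_class \<mu> p) = a *\<^sub>C v"
    unfolding v_def by (rule RSE_norming_circle[OF S ball[OF f] _ ball[OF p]]) (use S1 n in simp_all)
  obtain b where b: "cmod b = 1" "S (ae_class \<mu> q) = b *\<^sub>C v"
    unfolding v_def by (rule RSE_norming_circle[OF S ball[OF f] _ ball[OF q]]) (use S1 n in simp_all)
  have "(a + b - 2) *\<^sub>C v = 0"
  proof -
    have "a *\<^sub>C v + b *\<^sub>C v = 2 *\<^sub>C v"
      unfolding a(2)[symmetric] b(2)[symmetric] Sp Sq using scaleC_of_real[of 2 v] by (simp add: scaleR_2)
    then show ?thesis by (simp add: scaleC_add_left scaleC_diff_left)
  qed
  then have "cmod (a + b - 2) * norm v = 0" by (metis norm_scaleC norm_zero)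
  then have "a + b = 2" using S1(2) by (simp add: v_def)
  then have "a = 1" by (rule unimodular_sum_two[OF a(1) b(1)])
  then show ?thesis using a(2) Sp by simp
qed

section \<open>The two implications\<close>

lemma C_uniformly_convex_if_BPBp_RSE:
  assumes dim: "dim_ge_two (Linf (\<mu> :: 'a measure))"
    and bpb: "BPBp_RSE (Linf \<mu>) (compact_ops (Linf \<mu>) :: (('a \<Rightarrow> complex) set \<Rightarrow> 'y::complex_banach) set)"
  shows "C_uniformly_convex TYPE('y)"
proof (rule ccontr)
  assume "\<not> ?thesis"
  then obtain \<epsilon> where \<epsilon>: "\<epsilon> > 0"
    and bad: "\<And>\<delta>. \<delta> > 0 \<Longrightarrow> \<exists>y0 y1 :: 'y. (\<forall>w. cmod w = 1 \<longrightarrow> norm (y0 + w *\<^sub>C y1) \<le> 1) \<and> norm y1 > \<epsilon> \<and> norm y0 \<ge> 1 - \<delta>"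
    unfolding C_uniformly_convex_def by (metis not_less)
  obtain A where A: "A \<in> sets \<mu>" "\<not> (AE t in \<mu>. t \<in> A)" "\<not> (AE t in \<mu>. t \<notin> A)"
    by (rule dim_ge_two_split[OF dim])
  \<comment> \<open>The bound \<open>1 / 2\<close> leaves room, off \<open>A\<close>, for half of the indicator of the complement next to
    a function that is \<open>e\<close>-close to the indicator of \<open>A\<close>.\<close>
  define e where "e = min \<epsilon> (1 / 2)"
  have e: "e > 0" "e \<le> \<epsilon>" "e \<le> 1 / 2" using \<epsilon> by (auto simp: e_def)
  obtain \<eta> where \<eta>': "0 < \<eta> \<and> \<eta> < e \<and>
        (\<forall>T \<in> compact_ops (Linf \<mu>) :: (('a \<Rightarrow> complex) set \<Rightarrow> 'y) set. opnorm (Linf \<mu>) T = 1 \<longrightarrow>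
          (\<forall>x \<in> unit_sphere (Linf \<mu>). norm (T x) > 1 - \<eta> \<longrightarrow>
            (\<exists>S \<in> RSE (Linf \<mu>) \<inter> compact_ops (Linf \<mu>). \<exists>x0 \<in> unit_sphere (Linf \<mu>).
               opnorm (Linf \<mu>) S = 1 \<and> norm (S x0) = 1 \<and>
               opnorm (Linf \<mu>) (\<lambda>z. S z - T z) < e \<and> cs_nrm (Linf \<mu>) (cs_diff (Linf \<mu>) x x0) < e)))"
    by (rule exE[OF mp[OF spec[OF bpb[unfolded BPBp_RSE_def]] e(1)]])
  note \<eta> = conjunct1[OF \<eta>'] and approx = conjunct2[OF conjunct2[OF \<eta>'], rule_format]
  obtain y0 y1 :: 'y where y: "\<And>w. cmod w = 1 \<Longrightarrow> norm (y0 + w *\<^sub>C y1) \<le> 1" "norm y1 > \<epsilon>" "norm y0 \<ge> 1 - min (\<eta> / 2) (1 / 2)"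
    using bad[of "min (\<eta> / 2) (1 / 2)"] \<eta> by auto
  obtain \<phi> :: "('a \<Rightarrow> complex) \<Rightarrow> complex" where \<phi>:
    "\<And>f g. f \<in> ess_bounded \<mu> \<Longrightarrow> g \<in> ess_bounded \<mu> \<Longrightarrow> \<phi> (\<lambda>t. f t + g t) = \<phi> f + \<phi> g"
    "\<And>a f. f \<in> ess_bounded \<mu> \<Longrightarrow> \<phi> (\<lambda>t. a * f t) = a * \<phi> f"
    "\<And>f. f \<in> ess_ball \<mu> 1 \<Longrightarrow> cmod (\<phi> f) \<le> 1"
    "\<And>f z. (\<And>t. t \<in> A \<Longrightarrow> f t = z) \<Longrightarrow> \<phi> f = z"
    using ultralimit_functional[OF A(3)] by blast
  have "\<not> (AE t in \<mu>. t \<notin> - A)" using A(2) by simp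
  then obtain \<psi> :: "('a \<Rightarrow> complex) \<Rightarrow> complex" where \<psi>:
    "\<And>f g. f \<in> ess_bounded \<mu> \<Longrightarrow> g \<in> ess_bounded \<mu> \<Longrightarrow> \<psi> (\<lambda>t. f t + g t) = \<psi> f + \<psi> g"
    "\<And>a f. f \<in> ess_bounded \<mu> \<Longrightarrow> \<psi> (\<lambda>t. a * f t) = a * \<psi> f"
    "\<And>f. f \<in> ess_ball \<mu> 1 \<Longrightarrow> cmod (\<psi> f) \<le> 1"
    "\<And>f z. (\<And>t. t \<in> - A \<Longrightarrow> f t = z) \<Longrightarrow> \<psi> f = z"
    using ultralimit_functional[of "- A" \<mu>] by blast
  define \<kappa> where "\<kappa> t = (if t \<in> A then 1 else (0::complex))" for t
  define \<kappa>' where "\<kappa>' t = (if t \<in> A then 0 else (1::complex))" for t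
  have [measurable]: "\<kappa> \<in> borel_measurable \<mu>" "\<kappa>' \<in> borel_measurable \<mu>"
    using A(1) unfolding \<kappa>_def \<kappa>'_def by measurable
  have \<kappa>: "\<kappa> \<in> ess_ball \<mu> 1" and \<kappa>': "\<kappa>' \<in> ess_ball \<mu> 1" by (rule ess_ballI; simp add: \<kappa>_def \<kappa>'_def)+
  define G where "G f = \<phi> f *\<^sub>C y0 + \<psi> f *\<^sub>C y1" for f
  have Gb: "norm (G f) \<le> 1" if "f \<in> ess_ball \<mu> 1" for f
    unfolding G_def by (rule norm_bidisc_le[OF y(1) \<phi>(3)[OF that] \<psi>(3)[OF that]])
  have G: "ess_operator \<mu> 1 G"
    by (rule ess_operatorI)
      (simp_all add: Gb, simp_all add: G_def \<phi> \<psi> scaleC_add_left scaleC_add_right scaleC_scaleC)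
  have "\<phi> \<kappa> = 1" "\<psi> \<kappa> = 0" by (rule \<phi>(4) \<psi>(4); simp add: \<kappa>_def)+
  then have G\<kappa>: "G \<kappa> = y0" by (simp add: G_def)
  have "\<phi> \<kappa>' = 0" "\<psi> \<kappa>' = 1" by (rule \<phi>(4) \<psi>(4); simp add: \<kappa>'_def)+
  then have G\<kappa>': "G \<kappa>' = y1" by (simp add: G_def)
  have Gc: "compact (closure (G ` ess_ball \<mu> 1))"
  proof (rule compact_closure_subset)
    show "compact ((\<lambda>z. fst z *\<^sub>C y0 + snd z *\<^sub>C y1) ` (cball 0 1 \<times> cball 0 1))"
      by (intro compact_continuous_image continuous_intros compact_Times compact_cball)
    show "G ` ess_ball \<mu> 1 \<subseteq> (\<lambda>z. fst z *\<^sub>C y0 + snd z *\<^sub>C y1) ` (cball 0 1 \<times> cball 0 1)"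
      using \<phi>(3) \<psi>(3) by (force simp: G_def)
  qed
  define T0 where "T0 = (\<lambda>B. G (ae_rep B))"
  note T0 = ess_operator_lift[OF G T0_def]
  define r where "r = opnorm (Linf \<mu>) T0"
  have r: "norm y0 \<le> r" "r \<le> 1"
  proof -
    show "norm y0 \<le> r" using opnorm_upper[OF T0(1) \<kappa>] T0(2)[OF ess_ball_bounded[OF \<kappa>]] by (simp add: r_def G\<kappa>)
    show "r \<le> 1" unfolding r_def by (rule opnorm_least) (simp add: Gb T0(2)[OF ess_ball_bounded])
  qed
  have y0: "norm y0 \<ge> 1 / 2" "norm y0 > 1 - \<eta>" using y(3) \<eta> by auto
  then have r0: "r > 0" using r(1) by linarith
  \<comment> \<open>Normalizing can only lengthen the images of both indicators, as \<open>r \<le> 1\<close>.\<close>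
  define F where "F f = complex_of_real (1 / r) *\<^sub>C G f" for f
  have nF: "norm (F f) = norm (G f) / r" for f using r0 by (simp add: F_def norm_scaleC norm_divide)
  have F: "ess_operator \<mu> 1 F"
  proof (rule ess_operatorI)
    show "norm (F f) \<le> 1" if "f \<in> ess_ball \<mu> 1" for f
      using opnorm_upper[OF T0(1) that] T0(2)[OF ess_ball_bounded[OF that]] r0 by (simp add: nF r_def)
  qed (simp_all add: F_def ess_operator_add[OF G] ess_operator_cmult[OF G] scaleC_add_right scaleC_scaleC mult.commute)
  have "F ` ess_ball \<mu> 1 = (\<lambda>y. complex_of_real (1 / r) *\<^sub>C y) ` G ` ess_ball \<mu> 1" by (auto simp: F_def)
  moreover have "continuous_on UNIV (\<lambda>y :: 'y. complex_of_real (1 / r) *\<^sub>C y)" by (intro continuous_intros)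
  ultimately have Fc: "compact (closure (F ` ess_ball \<mu> 1))" using compact_closure_image[OF _ Gc] by metis
  define T where "T = (\<lambda>B. F (ae_rep B))"
  note T = ess_operator_lift[OF F T_def]
  have T1: "opnorm (Linf \<mu>) T = 1"
  proof (rule antisym)
    show "opnorm (Linf \<mu>) T \<le> 1"
      by (rule opnorm_least) (use ess_operator_bound[OF F, of _ 1] T(2) ess_ball_bounded in fastforce)
    have "r \<le> r * opnorm (Linf \<mu>) T"
      unfolding r_def
    proof (rule opnorm_least, unfold r_def[symmetric])
      fix f :: "'a \<Rightarrow> complex" assume f: "f \<in> ess_ball \<mu> 1"
      have "norm (G f) / r \<le> opnorm (Linf \<mu>) T"
        using opnorm_upper[OF T(1) f] T(2)[OF ess_ball_bounded[OF f]] by (simp add: nF)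
      then show "norm (T0 (ae_class \<mu> f)) \<le> r * opnorm (Linf \<mu>) T"
        using T0(2)[OF ess_ball_bounded[OF f]] r0 by (simp add: field_simps)
    qed
    then show "1 \<le> opnorm (Linf \<mu>) T" using r0 by simp
  qed
  have \<kappa>b: "\<kappa> \<in> ess_bounded \<mu>" and \<kappa>b': "\<kappa>' \<in> ess_bounded \<mu>" using \<kappa> \<kappa>' ess_ball_bounded by auto
  have \<kappa>S: "ae_class \<mu> \<kappa> \<in> unit_sphere (Linf \<mu>)"
  proof -
    let ?n = "cs_nrm (Linf \<mu>) (ae_class \<mu> \<kappa>)"
    have "?n \<le> 1" using Linf_nrm_le_iff[OF \<kappa>b, of 1] \<kappa> by simp
    moreover have "\<kappa> \<in> ess_ball \<mu> ?n" using Linf_nrm_le_iff[OF \<kappa>b Linf_nrm_nonneg[OF \<kappa>b]] by simp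
    then have ae: "AE t in \<mu>. cmod (\<kappa> t) \<le> ?n" by (rule ess_ball_AE)
    have "\<not> ?n < 1"
    proof
      assume n: "?n < 1"
      from ae have "AE t in \<mu>. t \<notin> A" by eventually_elim (use n in \<open>auto simp: \<kappa>_def\<close>)
      with A(3) show False by simp
    qed
    ultimately show ?thesis using \<kappa>b by (simp add: unit_sphere_def Linf_carrier)
  qed
  have T\<kappa>: "norm (T (ae_class \<mu> \<kappa>)) > 1 - \<eta>"
  proof -
    have "norm y0 * r \<le> norm y0 * 1" using r by (intro mult_left_mono) auto
    then have "norm y0 \<le> norm y0 / r" using r0 by (simp add: field_simps)
    then show ?thesis using y0(2) T(2)[OF \<kappa>b] by (simp add: nF G\<kappa>)
  qed
  obtain S x0 where S: "S \<in> RSE (Linf \<mu>)" "S \<in> compact_ops (Linf \<mu>)" and x0: "x0 \<in> unit_sphere (Linf \<mu>)"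
    and S1: "opnorm (Linf \<mu>) S = 1" "norm (S x0) = 1"
    and ST: "opnorm (Linf \<mu>) (\<lambda>z. S z - T z) < e" and near: "cs_nrm (Linf \<mu>) (cs_diff (Linf \<mu>) (ae_class \<mu> \<kappa>) x0) < e"
    using approx[OF T(3)[OF Fc] T1 \<kappa>S T\<kappa>] by (elim bexE conjE IntE)
  obtain f where f: "f \<in> ess_bounded \<mu>" "x0 = ae_class \<mu> f" and "cs_nrm (Linf \<mu>) x0 = 1"
    using x0 by (auto simp: unit_sphere_def Linf_carrier)
  then have f1: "f \<in> ess_ball \<mu> 1" using Linf_nrm_le_iff[OF f(1), of 1] by simp
  have "(\<lambda>t. \<kappa> t - f t) \<in> ess_ball \<mu> e"
    using near Linf_nrm_le_iff[OF ess_bounded_diff[OF \<kappa>b f(1)], of e] e(1) by (simp add: f(2) Linf_diff[OF \<kappa>b f(1)])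
  then have cf: "AE t in \<mu>. cmod (\<kappa> t - f t) \<le> e" by (rule ess_ball_AE)
  define g where "g = (\<lambda>t. (1/2) * \<kappa>' t)"
  have g: "g \<in> ess_bounded \<mu>" unfolding g_def by (rule ess_bounded_cmult[OF \<kappa>b'])
  have Sb: "S \<in> bounded_ops (Linf \<mu>)" using S(2) by (simp add: compact_ops_def)
  have H: "ess_operator \<mu> 1 (\<lambda>f. S (ae_class \<mu> f))" using ess_operator_opnorm[OF Sb] S1(1) by simp
  have "S (ae_class \<mu> g) = 0"
  proof (rule RSE_kills_small_support[OF S(1) S1(1) _ f1 g])
    show "norm (S (ae_class \<mu> f)) = 1" using S1(2) f(2) by simp
    show "AE t in \<mu>. cmod (f t) + cmod (g t) \<le> 1"
      using ess_ball_AE[OF f1] cf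
    proof eventually_elim
      case (elim t)
      then show ?case using e(3) by (cases "t \<in> A") (auto simp: g_def \<kappa>_def \<kappa>'_def norm_mult)
    qed
  qed
  then have "(1/2) *\<^sub>C S (ae_class \<mu> \<kappa>') = 0"
    unfolding g_def using ess_operator_cmult[OF H \<kappa>b', of "1/2"] by simp
  then have "norm ((1/2) *\<^sub>C S (ae_class \<mu> \<kappa>')) = 0" by simp
  then have S\<kappa>': "S (ae_class \<mu> \<kappa>') = 0" unfolding norm_scaleC by simp
  have "ess_operator \<mu> 2 (\<lambda>f. S (ae_class \<mu> f) - T (ae_class \<mu> f))"
  proof (rule ess_operatorI)
    fix f :: "'a \<Rightarrow> complex" assume f: "f \<in> ess_ball \<mu> 1"
    have "norm (S (ae_class \<mu> f)) \<le> 1" using ess_operator_bound[OF H f] by simp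
    moreover have "norm (T (ae_class \<mu> f)) \<le> 1" using opnorm_upper[OF T(1) f] T1 by simp
    ultimately show "norm (S (ae_class \<mu> f) - T (ae_class \<mu> f)) \<le> 2"
      using norm_triangle_ineq4[of "S (ae_class \<mu> f)" "T (ae_class \<mu> f)"] by linarith
  qed (simp_all add: ess_operator_add[OF H] ess_operator_cmult[OF H] T(2) ess_operator_add[OF F] ess_operator_cmult[OF F]
      ess_bounded_add ess_bounded_cmult scaleC_diff_right)
  then have "(\<lambda>z. S z - T z) \<in> bounded_ops (Linf \<mu>)" unfolding bounded_ops_iff by blast
  from opnorm_upper[OF this \<kappa>'] have "norm (T (ae_class \<mu> \<kappa>')) < e" using ST S\<kappa>' by simp
  moreover have "norm (T (ae_class \<mu> \<kappa>')) = norm y1 / r" using T(2)[OF \<kappa>b'] by (simp add: nF G\<kappa>')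
  moreover have "norm y1 \<le> norm y1 / r"
    using r r0 mult_left_mono[of r 1 "norm y1"] by (simp add: field_simps)
  ultimately show False using y(2) e(2) by simp
qed

lemma BPBp_RSE_if_C_uniformly_convex:
  assumes Y: "C_uniformly_convex TYPE('y::complex_banach)"
  shows "BPBp_RSE (Linf \<mu>) (compact_ops (Linf \<mu>) :: (('a \<Rightarrow> complex) set \<Rightarrow> 'y) set)"
  unfolding BPBp_RSE_def
proof (intro allI impI)
  fix \<epsilon> :: real assume \<epsilon>: "\<epsilon> > 0"
  then have e: "\<epsilon> / 2 > 0" by simp
  obtain \<eta>0 where \<eta>0: "\<eta>0 > 0"
    "\<And>(G :: ('a \<Rightarrow> complex) \<Rightarrow> 'y) u. ess_operator \<mu> 1 G \<Longrightarrow> compact (closure (G ` ess_ball \<mu> 1)) \<Longrightarrow>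
      u \<in> ess_ball \<mu> 1 \<Longrightarrow> norm (G u) > 1 - \<eta>0 \<Longrightarrow>
      \<exists>H x0. ess_operator \<mu> 1 H \<and> compact (closure (H ` ess_ball \<mu> 1)) \<and> x0 \<in> ess_ball \<mu> 1 \<and> norm (H x0) = 1 \<and>
        (\<forall>f\<in>ess_ball \<mu> 1. norm (H f - G f) \<le> \<epsilon> / 2) \<and> (\<lambda>t. u t - x0 t) \<in> ess_ball \<mu> (\<epsilon> / 2) \<and>
        range_exposing \<mu> H x0"
    using bpb_rse_ess_operator[OF Y e] by blast
  define \<eta> where "\<eta> = min \<eta>0 (\<epsilon> / 2)"
  have \<eta>: "0 < \<eta>" "\<eta> < \<epsilon>" "\<eta> \<le> \<eta>0" using \<eta>0(1) \<epsilon> by (auto simp: \<eta>_def)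
  have "\<exists>S \<in> RSE (Linf \<mu>) \<inter> compact_ops (Linf \<mu>). \<exists>x0 \<in> unit_sphere (Linf \<mu>).
               opnorm (Linf \<mu>) S = 1 \<and> norm (S x0) = 1 \<and>
               opnorm (Linf \<mu>) (\<lambda>z. S z - T z) < \<epsilon> \<and> cs_nrm (Linf \<mu>) (cs_diff (Linf \<mu>) x x0) < \<epsilon>"
    if T: "T \<in> compact_ops (Linf \<mu>)" "opnorm (Linf \<mu>) T = 1" and x: "x \<in> unit_sphere (Linf \<mu>)"
      and Tx: "norm (T x) > 1 - \<eta>" for T :: "('a \<Rightarrow> complex) set \<Rightarrow> 'y" and x
  proof -
    have G: "ess_operator \<mu> 1 (\<lambda>f. T (ae_class \<mu> f))" and Gc: "compact (closure ((\<lambda>f. T (ae_class \<mu> f)) ` ess_ball \<mu> 1))"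
      using T ess_operator_opnorm[of T \<mu>] by (auto simp: compact_ops_Linf)
    obtain u where u: "u \<in> ess_bounded \<mu>" "x = ae_class \<mu> u" and "cs_nrm (Linf \<mu>) x = 1"
      using x by (auto simp: unit_sphere_def Linf_carrier)
    then have u1: "u \<in> ess_ball \<mu> 1" using Linf_nrm_le_iff[OF u(1), of 1] by simp
    have "norm (T (ae_class \<mu> u)) > 1 - \<eta>0" using Tx \<eta> u(2) by simp
    then obtain H f0 where H: "ess_operator \<mu> 1 H" "compact (closure (H ` ess_ball \<mu> 1))" "f0 \<in> ess_ball \<mu> 1" "norm (H f0) = 1"
      "\<And>f. f\<in>ess_ball \<mu> 1 \<Longrightarrow> norm (H f - T (ae_class \<mu> f)) \<le> \<epsilon> / 2" "(\<lambda>t. u t - f0 t) \<in> ess_ball \<mu> (\<epsilon> / 2)"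
      "range_exposing \<mu> H f0"
      using \<eta>0(2)[OF G Gc u1] by blast
    define S where "S = (\<lambda>B. H (ae_rep B))"
    note S = ess_operator_lift[OF H(1) S_def]
    have S': "S (ae_class \<mu> f) = H f" if "f \<in> ess_ball \<mu> 1" for f by (rule S(2)[OF ess_ball_bounded[OF that]])
    have f0: "f0 \<in> ess_bounded \<mu>" by (rule ess_ball_bounded[OF H(3)])
    have S1: "opnorm (Linf \<mu>) S = 1"
    proof (rule antisym)
      show "opnorm (Linf \<mu>) S \<le> 1"
        by (rule opnorm_least) (use ess_operator_bound[OF H(1), of _ 1] S' in fastforce)
      show "1 \<le> opnorm (Linf \<mu>) S" using opnorm_upper[OF S(1) H(3)] S'[OF H(3)] H(4) by simp
    qed
    have x0: "ae_class \<mu> f0 \<in> unit_sphere (Linf \<mu>)"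
    proof -
      let ?n = "cs_nrm (Linf \<mu>) (ae_class \<mu> f0)"
      have "?n \<le> 1" using Linf_nrm_le_iff[OF f0, of 1] H(3) by simp
      moreover have "f0 \<in> ess_ball \<mu> ?n" using Linf_nrm_le_iff[OF f0 Linf_nrm_nonneg[OF f0]] by simp
      then have "1 \<le> ?n" using ess_operator_bound[OF H(1) _ Linf_nrm_nonneg[OF f0], of f0] H(4) by simp
      ultimately show ?thesis using f0 by (simp add: unit_sphere_def Linf_carrier)
    qed
    have "S \<in> RSE (Linf \<mu>)"
      unfolding RSE_def
    proof (intro CollectI conjI bexI[OF _ x0] allI impI S(1))
      fix z :: "nat \<Rightarrow> ('a \<Rightarrow> complex) set"
      assume z: "(\<forall>n. z n \<in> unit_ball (Linf \<mu>)) \<and> (\<lambda>n. norm (S (z n))) \<longlonglongrightarrow> opnorm (Linf \<mu>) S"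
      then have "\<forall>n. \<exists>f. f \<in> ess_ball \<mu> 1 \<and> z n = ae_class \<mu> f" by (auto simp: unit_ball_Linf)
      then obtain f where f: "\<And>n. f n \<in> ess_ball \<mu> 1" "\<And>n. z n = ae_class \<mu> (f n)" by metis
      have Sz: "S (z n) = H (f n)" for n using S'[OF f(1)] f(2) by simp
      have "(\<lambda>n. norm (H (f n))) \<longlonglongrightarrow> 1" using z S1 by (simp add: Sz)
      then show "\<exists>\<sigma> c. strict_mono \<sigma> \<and> cmod c = 1 \<and> (\<lambda>n. S (z (\<sigma> n))) \<longlonglongrightarrow> c *\<^sub>C S (ae_class \<mu> f0)"
        using H(7) f(1) unfolding range_exposing_def Sz S'[OF H(3)] by blast
    qed
    moreover have "opnorm (Linf \<mu>) (\<lambda>z. S z - T z) < \<epsilon>"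
    proof -
      have "opnorm (Linf \<mu>) (\<lambda>z. S z - T z) \<le> \<epsilon> / 2" by (rule opnorm_least) (use H(5) S' in auto)
      then show ?thesis using \<epsilon> by simp
    qed
    moreover have "cs_nrm (Linf \<mu>) (cs_diff (Linf \<mu>) x (ae_class \<mu> f0)) < \<epsilon>"
      using Linf_nrm_le_iff[OF ess_bounded_diff[OF u(1) f0], of "\<epsilon> / 2"] H(6) \<epsilon> by (simp add: u(2) Linf_diff[OF u(1) f0])
    ultimately show ?thesis using x0 S(3)[OF H(2)] S1 S'[OF H(3)] H(4)
      by (intro bexI[of _ S] bexI[of _ "ae_class \<mu> f0"]) auto
  qed
  with \<eta> show "\<exists>\<eta>. 0 < \<eta> \<and> \<eta> < \<epsilon> \<and> (\<forall>T \<in> compact_ops (Linf \<mu>) :: (('a \<Rightarrow> complex) set \<Rightarrow> 'y) set. opnorm (Linf \<mu>) T = 1 \<longrightarrow>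
          (\<forall>x \<in> unit_sphere (Linf \<mu>). norm (T x) > 1 - \<eta> \<longrightarrow>
            (\<exists>S \<in> RSE (Linf \<mu>) \<inter> compact_ops (Linf \<mu>). \<exists>x0 \<in> unit_sphere (Linf \<mu>).
               opnorm (Linf \<mu>) S = 1 \<and> norm (S x0) = 1 \<and>
               opnorm (Linf \<mu>) (\<lambda>z. S z - T z) < \<epsilon> \<and> cs_nrm (Linf \<mu>) (cs_diff (Linf \<mu>) x x0) < \<epsilon>)))"
    by blast
qed

theorem corollary4p9:
  fixes \<mu> :: "'a measure"
  assumes "dim_ge_two (cspace_of TYPE('y::complex_banach))"
    and "dim_ge_two (Linf \<mu>)"
  shows "BPBp_RSE (Linf \<mu>) (compact_ops (Linf \<mu>) :: (('a \<Rightarrow> complex) set \<Rightarrow> 'y) set)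
         \<longleftrightarrow> C_uniformly_convex TYPE('y)"
  using C_uniformly_convex_if_BPBp_RSE[OF assms(2)] BPBp_RSE_if_C_uniformly_convex by blast

end
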